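(* Let $G$ be a Lie group with Lie algebra $\mathfrak g$, let $L_d:G\times G\to\mathbb R$ be a left-invariant discrete Lagrangian with reduced discrete Lagrangian $l_d:G\to\mathbb R$, and let $\mathcal D\subset TG$ and $\mathcal D_d\subset G\times G$ be compatible left-invariant constraint distribution and discrete constraint manifold, determined by $a^1,\dots,a^s\in\mathfrak g^*$ and $f_1,\dots,f_s:G\to\mathbb R$ respectively. Let $g_0,\dots,g_N\in G$ be a sequence with $(g_k,g_{k+1})\in\mathcal D_d$ for $k=0,\dots,N-1$, and put $W_k=g_k^{-1}g_{k+1}$. Then the following statements are equivalent: (i) The sequence $\{(g_k,g_{k+1})\}_{k=0}^{N-1}$ is a critical point of the action sum $S_d:G^{N+1}\to\mathbb R$, $S_d=\sum_{k=0}^{N-1}L_d(g_k,g_{k+1})$, for arbitrary constrained variations. (ii) The sequence $\{(g_k,g_{k+1})\}_{k=0}^{N-1}$ satisfies the discrete Euler--Lagrange equations with multipliers: there are real numbers $\lambda_k^j$ such that $$D_1L_d(g_k,g_{k+1})+D_2L_d(g_{k-1},g_k)=\sum_{j=1}^s\lambda_k^jA^j(g_k),\qquad k=1,\dots,N-1,$$ coupled with the discrete constraint equations $f_j(g_k^{-1}g_{k+1})=0$, $j=1,\dots,s$. (iii) The sequence $\{W_k\}_{k=0}^{N-1}$ is a critical point of the reduced action sum $s_d=\sum_{k=0}^{N-1}l_d(W_k)$, $s_d:G^{N}\to\mathbb R$, with respect to the variations $\delta W_k$ induced by the constrained variations $\delta g_k$ and given by $$\delta W_k=W_k\left[g_{k+1}^{-1}\delta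 g_{k+1}-\mathrm{Ad}_{W_k^{-1}}\big(g_k^{-1}\delta g_k\big)\right].$$ (iv) The sequence $\{W_k\}_{k=0}^{N-1}$ satisfies, for some real numbers $\lambda_k^j$, the equations (equalities in $\mathfrak g^*$) $$l_d'(W_{k-1})\,TL_{W_{k-1}}-l_d'(W_k)\,TL_{W_k}\,\mathrm{Ad}_{W_k^{-1}}=\sum_{j=1}^s\lambda_k^ja^j,\qquad k=1,\dots,N-1,$$ coupled with the discrete constraint equations $f_j(W_k)=0$, $j=1,\dots,s$, $k=0,\dots,N-1$.
   Context: $L_g:G\to G$ is left translation and $TL_g$ its tangent map; for $\xi\in\mathfrak g$, $TL_W\xi=W\xi\in T_WG$, and for $v\in T_gG$, $g^{-1}v\in\mathfrak g$ denotes $TL_{g^{-1}}v$. $D_1L_d,D_2L_d$ are the partial differentials of $L_d$ in its first and second arguments; $l_d'(W)\in T_W^*G$ is the differential of $l_d$. All functions are smooth. $L_d$ is left-invariant: $L_d(gg_k,gg_{k+1})=L_d(g_k,g_{k+1})$ for all $g\in G$; the reduced discrete Lagrangian $l_d$ is defined by $L_d(g_k,g_{k+1})=l_d(g_k^{-1}g_{k+1})$. The left-invariant distribution $\mathcal D$ is generated by the subspace $\mathfrak d=\{\xi\in\mathfrak g\mid\langle a^j,\xi\rangle=0,\ j=1,\dots,s\}$, where $a^1,\dots,a^s\in\mathfrak g^*$ are linearly independent: $\mathcal D_g=TL_g\,\mathfrak d$. The one-forms $A^j$ on $G$ are the corresponding left-invariant forms, $\langle A^j(g),v\rangle=\langle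 a^j,g^{-1}v\rangle$ for $v\in T_gG$. The left-invariant discrete constraint manifold is $\mathcal D_d=\{(g,gW)\mid g\in G,\ W\in\mathcal S\}$ with $\mathcal S=\{W\in G\mid f_1(W)=\dots=f_s(W)=0\}$. Compatibility of $\mathcal D$ and $\mathcal D_d$ means that $\mathcal D_d$ has the same dimension as $\mathcal D$, $(g,g)\in\mathcal D_d$ for all $g$ (i.e. $\mathcal S$ contains the identity $e$), and $T_e\mathcal S=\mathfrak d$. Constrained variations are $\delta g_k\in T_{g_k}G$, $k=0,\dots,N$, with $\delta g_0=\delta g_N=0$ and $\langle a^j,g_k^{-1}\delta g_k\rangle=0$ for $j=1,\dots,s$, $k=1,\dots,N-1$. Being a critical point for such variations means that the first variation of the sum vanishes for all of them. The variation is taken before imposing the discrete constraints, i.e. varied sequences are not required to lie in $\mathcal D_d$. *)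

theory Defs
  imports
    "HOL-Analysis.Analysis"
    "HOL-Library.Function_Algebras"
    "HOL-Algebra.Group"
begin

section \<open>Linear algebra in function spaces\<close>

text \<open>Pointwise scaling, so that \<^const>\<open>span\<close>, \<^const>\<open>independent\<close> and \<^const>\<open>dim\<close> apply to tangent
  vectors and to linear forms, both of which are functions below.\<close>

instantiation "fun" :: (type, real_vector) real_vector
begin

definition scaleR_fun :: "real \<Rightarrow> ('a \<Rightarrow> 'b) \<Rightarrow> 'a \<Rightarrow> 'b" where
  "scaleR_fun r f = (\<lambda>x. r *\<^sub>R f x)"

instance
  by standard (auto simp: scaleR_fun_def fun_eq_iff scaleR_add_right scaleR_add_left)

end

text \<open>Linear forms on the subspace \<open>V\<close>, extended by 0 outside \<open>V\<close>. In this way two forms are equal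
  iff they agree on \<open>V\<close>, and linear independence of forms is \<^const>\<open>independent\<close>.\<close>

definition dual_space :: "'v::real_vector set \<Rightarrow> ('v \<Rightarrow> real) set" where
  "dual_space V = {\<alpha>.
     (\<forall>x\<in>V. \<forall>y\<in>V. \<alpha> (x + y) = \<alpha> x + \<alpha> y) \<and>
     (\<forall>r. \<forall>x\<in>V. \<alpha> (r *\<^sub>R x) = r * \<alpha> x) \<and>
     (\<forall>x. x \<notin> V \<longrightarrow> \<alpha> x = 0)}"


section \<open>Smooth manifolds\<close>

text \<open>Smoothness on an open set of a finite-dimensional space.\<close>

primrec Ck_on :: "nat \<Rightarrow> ('e::real_normed_vector \<Rightarrow> 'f::real_normed_vector) \<Rightarrow> 'e set \<Rightarrow> bool" where
  "Ck_on 0 f S \<longleftrightarrow> continuous_on S f"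
| "Ck_on (Suc k) f S \<longleftrightarrow>
     (\<exists>f'. (\<forall>x\<in>S. (f has_derivative f' x) (at x)) \<and> (\<forall>v. Ck_on k (\<lambda>x. f' x v) S))"

definition smooth_on :: "('e::real_normed_vector \<Rightarrow> 'f::real_normed_vector) \<Rightarrow> 'e set \<Rightarrow> bool" where
  "smooth_on f S \<longleftrightarrow> (\<forall>k. Ck_on k f S)"

type_synonym ('a, 'e) chart = "'a set \<times> ('a \<Rightarrow> 'e)"

record ('a, 'e) manifold =
  topo :: "'a topology"
  atlas :: "('a, 'e) chart set"

definition is_chart :: "'a topology \<Rightarrow> ('a, 'e::real_normed_vector) chart \<Rightarrow> bool" where
  "is_chart T = (\<lambda>(U, \<phi>). openin T U \<and> open (\<phi> ` U) \<and>
     homeomorphic_map (subtopology T U) (top_of_set (\<phi> ` U)) \<phi>)"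

definition smooth_transition ::
    "('a, 'e::real_normed_vector) chart \<Rightarrow> ('a, 'e) chart \<Rightarrow> bool" where
  "smooth_transition = (\<lambda>(U, \<phi>) (V, \<psi>). smooth_on (\<lambda>x. \<psi> (inv_into U \<phi> x)) (\<phi> ` (U \<inter> V)))"

text \<open>The model space \<open>'e\<close> is any finite-dimensional normed space. The class \<^class>\<open>euclidean_space\<close>
  would exclude manifolds of dimension 0. The atlas need not be maximal.\<close>

locale smooth_manifold =
  fixes M :: "('a, 'e::real_normed_vector) manifold"
  assumes finite_dimensional: "\<exists>B::'e set. finite B \<and> span B = UNIV"
    and Hausdorff: "Hausdorff_space (topo M)"
    and second_countable: "second_countable (topo M)"
    and charts: "\<And>c. c \<in> atlas M \<Longrightarrow> is_chart (topo M) c"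
    and cover: "topspace (topo M) = (\<Union>c\<in>atlas M. fst c)"
    and transitions: "\<And>c d. c \<in> atlas M \<Longrightarrow> d \<in> atlas M \<Longrightarrow> smooth_transition c d"

definition open_manifold :: "'e::real_normed_vector set \<Rightarrow> ('e, 'e) manifold" where
  "open_manifold S = \<lparr>topo = top_of_set S, atlas = {(S, id)}\<rparr>"

definition prod_manifold ::
    "('a, 'e) manifold \<Rightarrow> ('b, 'f) manifold \<Rightarrow> ('a \<times> 'b, 'e \<times> 'f) manifold" where
  "prod_manifold M N =
     \<lparr>topo = prod_topology (topo M) (topo N),
      atlas = {(U \<times> V, map_prod \<phi> \<psi>) | U \<phi> V \<psi>. (U, \<phi>) \<in> atlas M \<and> (V, \<psi>) \<in> atlas N}\<rparr>"

definition smooth_map ::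
    "('a, 'e::real_normed_vector) manifold \<Rightarrow> ('b, 'f::real_normed_vector) manifold \<Rightarrow> ('a \<Rightarrow> 'b) \<Rightarrow> bool" where
  "smooth_map M N F \<longleftrightarrow> continuous_map (topo M) (topo N) F \<and>
     (\<forall>(U, \<phi>)\<in>atlas M. \<forall>(V, \<psi>)\<in>atlas N.
        smooth_on (\<lambda>x. \<psi> (F (inv_into U \<phi> x))) (\<phi> ` (U \<inter> F -` V)))"

definition smooth_function :: "('a, 'e::real_normed_vector) manifold \<Rightarrow> ('a \<Rightarrow> real) \<Rightarrow> bool" where
  "smooth_function M F \<longleftrightarrow> smooth_map M (open_manifold UNIV) F"

text \<open>Curves need only be defined and smooth near time 0.\<close>

definition smooth_curve :: "('a, 'e::real_normed_vector) manifold \<Rightarrow> (real \<Rightarrow> 'a) \<Rightarrow> bool" where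
  "smooth_curve M c \<longleftrightarrow> (\<exists>\<epsilon>>0. smooth_map (open_manifold {-\<epsilon><..<\<epsilon>}) M c)"


section \<open>Tangent vectors\<close>

text \<open>A tangent vector at \<open>p\<close> is the family of its components in all charts around \<open>p\<close>; the
  components transform by the derivatives of the chart transitions. The value at all other
  arguments is 0.\<close>

type_synonym ('a, 'e) tangent_vector = "('a, 'e) chart \<Rightarrow> 'e"

definition charts_at :: "('a, 'e) manifold \<Rightarrow> 'a \<Rightarrow> ('a, 'e) chart set" where
  "charts_at M p = {c \<in> atlas M. p \<in> fst c}"

definition tangent_space ::
    "('a, 'e::real_normed_vector) manifold \<Rightarrow> 'a \<Rightarrow> ('a, 'e) tangent_vector set" where
  "tangent_space M p = {v.
     (\<forall>(U, \<phi>)\<in>charts_at M p. \<forall>(V, \<psi>)\<in>charts_at M p.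
        v (V, \<psi>) = frechet_derivative (\<lambda>x. \<psi> (inv_into U \<phi> x)) (at (\<phi> p)) (v (U, \<phi>))) \<and>
     (\<forall>c. c \<notin> charts_at M p \<longrightarrow> v c = 0)}"

text \<open>The differential at \<open>p\<close> of a vector-valued function defined near \<open>p\<close>. For \<open>v\<close> in the tangent
  space at \<open>p\<close> the value does not depend on the chart that is chosen.\<close>

definition differential ::
    "('a, 'e::real_normed_vector) manifold \<Rightarrow> ('a \<Rightarrow> 'f::real_normed_vector) \<Rightarrow> 'a \<Rightarrow> ('a, 'e) tangent_vector \<Rightarrow> 'f" where
  "differential M F p v =
     (let (U, \<phi>) = (SOME c. c \<in> charts_at M p)
      in frechet_derivative (\<lambda>x. F (inv_into U \<phi> x)) (at (\<phi> p)) (v (U, \<phi>)))"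

definition tangent_map ::
    "('a, 'e::real_normed_vector) manifold \<Rightarrow> ('b, 'f::real_normed_vector) manifold \<Rightarrow> ('a \<Rightarrow> 'b) \<Rightarrow> 'a \<Rightarrow>
     ('a, 'e) tangent_vector \<Rightarrow> ('b, 'f) tangent_vector" where
  "tangent_map M N F p v =
     (\<lambda>(V, \<psi>). if (V, \<psi>) \<in> charts_at N (F p) then differential M (\<lambda>x. \<psi> (F x)) p v else 0)"

definition velocity ::
    "('a, 'e::real_normed_vector) manifold \<Rightarrow> (real \<Rightarrow> 'a) \<Rightarrow> ('a, 'e) tangent_vector" where
  "velocity M c =
     (\<lambda>(U, \<phi>). if (U, \<phi>) \<in> charts_at M (c 0) then vector_derivative (\<lambda>t. \<phi> (c t)) (at 0) else 0)"

text \<open>Embedded submanifolds are given by slice charts; the slice charts are taken from the maximal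
  atlas.\<close>

definition embedded_submanifold ::
    "('a, 'e::real_normed_vector) manifold \<Rightarrow> 'a set \<Rightarrow> nat \<Rightarrow> bool" where
  "embedded_submanifold M S m \<longleftrightarrow> S \<subseteq> topspace (topo M) \<and>
     (\<forall>p\<in>S. \<exists>U \<phi> K. p \<in> U \<and> is_chart (topo M) (U, \<phi>) \<and>
        (\<forall>c\<in>atlas M. smooth_transition (U, \<phi>) c \<and> smooth_transition c (U, \<phi>)) \<and>
        subspace K \<and> dim K = m \<and> \<phi> ` (U \<inter> S) = \<phi> ` U \<inter> K)"

definition submanifold_tangent_space ::
    "('a, 'e::real_normed_vector) manifold \<Rightarrow> 'a set \<Rightarrow> 'a \<Rightarrow> ('a, 'e) tangent_vector set" where
  "submanifold_tangent_space M S p =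
     {velocity M c | c. smooth_curve M c \<and> c 0 = p \<and> (\<forall>\<^sub>F t in nhds 0. c t \<in> S)}"


section \<open>Lie groups\<close>

locale lie_group = group G + smooth_manifold M
  for G :: "'a monoid" (structure) and M :: "('a, 'e::real_normed_vector) manifold" +
  assumes carrier: "topspace (topo M) = carrier G"
    and smooth_mult: "smooth_map (prod_manifold M M) M (\<lambda>(x, y). x \<otimes> y)"
    and smooth_inv: "smooth_map M M (\<lambda>x. inv x)"

definition lie_algebra ::
    "'a monoid \<Rightarrow> ('a, 'e::real_normed_vector) manifold \<Rightarrow> ('a, 'e) tangent_vector set" where
  "lie_algebra G M = tangent_space M \<one>\<^bsub>G\<^esub>"

text \<open>\<open>TL G M g p v\<close> is $T_pL_g(v)$, an element of $T_{gp}G$.\<close>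

definition TL ::
    "'a monoid \<Rightarrow> ('a, 'e::real_normed_vector) manifold \<Rightarrow> 'a \<Rightarrow> 'a \<Rightarrow>
     ('a, 'e) tangent_vector \<Rightarrow> ('a, 'e) tangent_vector" where
  "TL G M g p = tangent_map M M (\<lambda>x. g \<otimes>\<^bsub>G\<^esub> x) p"

text \<open>$g\xi = TL_g\xi$ for $\xi$ in the Lie algebra, and $g^{-1}v = TL_{g^{-1}}v$ for $v \in T_gG$.\<close>

definition from_lie_algebra ::
    "'a monoid \<Rightarrow> ('a, 'e::real_normed_vector) manifold \<Rightarrow> 'a \<Rightarrow>
     ('a, 'e) tangent_vector \<Rightarrow> ('a, 'e) tangent_vector" where
  "from_lie_algebra G M g \<xi> = TL G M g \<one>\<^bsub>G\<^esub> \<xi>"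

definition to_lie_algebra ::
    "'a monoid \<Rightarrow> ('a, 'e::real_normed_vector) manifold \<Rightarrow> 'a \<Rightarrow>
     ('a, 'e) tangent_vector \<Rightarrow> ('a, 'e) tangent_vector" where
  "to_lie_algebra G M g v = TL G M (inv\<^bsub>G\<^esub> g) g v"

definition Ad ::
    "'a monoid \<Rightarrow> ('a, 'e::real_normed_vector) manifold \<Rightarrow> 'a \<Rightarrow>
     ('a, 'e) tangent_vector \<Rightarrow> ('a, 'e) tangent_vector" where
  "Ad G M g = tangent_map M M (\<lambda>x. g \<otimes>\<^bsub>G\<^esub> x \<otimes>\<^bsub>G\<^esub> inv\<^bsub>G\<^esub> g) \<one>\<^bsub>G\<^esub>"


section \<open>Constraints\<close>

definition constraint_subspace ::
    "'a monoid \<Rightarrow> ('a, 'e::real_normed_vector) manifold \<Rightarrow> nat \<Rightarrow>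
     (nat \<Rightarrow> ('a, 'e) tangent_vector \<Rightarrow> real) \<Rightarrow> ('a, 'e) tangent_vector set" where
  "constraint_subspace G M s a = {\<xi> \<in> lie_algebra G M. \<forall>j\<in>{1..s}. a j \<xi> = 0}"

definition constraint_distribution ::
    "'a monoid \<Rightarrow> ('a, 'e::real_normed_vector) manifold \<Rightarrow> nat \<Rightarrow>
     (nat \<Rightarrow> ('a, 'e) tangent_vector \<Rightarrow> real) \<Rightarrow> 'a \<Rightarrow> ('a, 'e) tangent_vector set" where
  "constraint_distribution G M s a g = from_lie_algebra G M g ` constraint_subspace G M s a"

definition left_invariant_form ::
    "'a monoid \<Rightarrow> ('a, 'e::real_normed_vector) manifold \<Rightarrow> (('a, 'e) tangent_vector \<Rightarrow> real) \<Rightarrow>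
     'a \<Rightarrow> ('a, 'e) tangent_vector \<Rightarrow> real" where
  "left_invariant_form G M \<alpha> g v = \<alpha> (to_lie_algebra G M g v)"

definition discrete_constraint_set :: "'a monoid \<Rightarrow> nat \<Rightarrow> (nat \<Rightarrow> 'a \<Rightarrow> real) \<Rightarrow> 'a set" where
  "discrete_constraint_set G s f = {W \<in> carrier G. \<forall>j\<in>{1..s}. f j W = 0}"

definition discrete_constraint_manifold ::
    "'a monoid \<Rightarrow> nat \<Rightarrow> (nat \<Rightarrow> 'a \<Rightarrow> real) \<Rightarrow> ('a \<times> 'a) set" where
  "discrete_constraint_manifold G s f =
     {(g, g \<otimes>\<^bsub>G\<^esub> W) | g W. g \<in> carrier G \<and> W \<in> discrete_constraint_set G s f}"

text \<open>The dimension of the distribution, as a submanifold of the tangent bundle, is the dimension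
  of the group plus the rank of the distribution.\<close>

definition compatible_constraints ::
    "'a monoid \<Rightarrow> ('a, 'e::real_normed_vector) manifold \<Rightarrow> nat \<Rightarrow>
     (nat \<Rightarrow> ('a, 'e) tangent_vector \<Rightarrow> real) \<Rightarrow> (nat \<Rightarrow> 'a \<Rightarrow> real) \<Rightarrow> bool" where
  "compatible_constraints G M s a f \<longleftrightarrow>
     (\<forall>g\<in>carrier G. embedded_submanifold (prod_manifold M M) (discrete_constraint_manifold G s f)
        (dim (UNIV :: 'e set) + dim (constraint_distribution G M s a g))) \<and>
     (\<forall>g\<in>carrier G. (g, g) \<in> discrete_constraint_manifold G s f) \<and>
     submanifold_tangent_space M (discrete_constraint_set G s f) \<one>\<^bsub>G\<^esub> = constraint_subspace G M s a"


section \<open>Variations and critical points\<close>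

text \<open>\<open>c k\<close>, for \<open>k < n\<close>, are curves through the points \<open>x k\<close> with velocities \<open>\<delta> k\<close>.\<close>

definition realizes_variation ::
    "('a, 'e::real_normed_vector) manifold \<Rightarrow> nat \<Rightarrow> (nat \<Rightarrow> 'a) \<Rightarrow> (nat \<Rightarrow> ('a, 'e) tangent_vector) \<Rightarrow>
     (nat \<Rightarrow> real \<Rightarrow> 'a) \<Rightarrow> bool" where
  "realizes_variation M n x \<delta> c \<longleftrightarrow>
     (\<forall>k<n. smooth_curve M (c k) \<and> c k 0 = x k \<and> velocity M (c k) = \<delta> k)"

text \<open>For a function \<open>F\<close> of the first \<open>n\<close> entries of a sequence in \<open>M\<close>: its first variation at
  \<open>x\<close> vanishes for all variations in \<open>V\<close>. The varied sequences are not constrained beyond their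
  velocities at 0.\<close>

definition critical_point ::
    "('a, 'e::real_normed_vector) manifold \<Rightarrow> nat \<Rightarrow> ((nat \<Rightarrow> 'a) \<Rightarrow> real) \<Rightarrow> (nat \<Rightarrow> 'a) \<Rightarrow>
     (nat \<Rightarrow> ('a, 'e) tangent_vector) set \<Rightarrow> bool" where
  "critical_point M n F x V \<longleftrightarrow>
     (\<forall>\<delta>\<in>V. \<forall>c. realizes_variation M n x \<delta> c \<longrightarrow>
        ((\<lambda>t. F (\<lambda>k. c k t)) has_real_derivative 0) (at 0))"

definition action_sum :: "('a \<times> 'a \<Rightarrow> real) \<Rightarrow> nat \<Rightarrow> (nat \<Rightarrow> 'a) \<Rightarrow> real" where
  "action_sum L N g = (\<Sum>k<N. L (g k, g (k + 1)))"

definition reduced_action_sum :: "('a \<Rightarrow> real) \<Rightarrow> nat \<Rightarrow> (nat \<Rightarrow> 'a) \<Rightarrow> real" where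
  "reduced_action_sum l N W = (\<Sum>k<N. l (W k))"

definition D1 ::
    "('a, 'e::real_normed_vector) manifold \<Rightarrow> ('a \<times> 'a \<Rightarrow> real) \<Rightarrow> 'a \<times> 'a \<Rightarrow> ('a, 'e) tangent_vector \<Rightarrow> real" where
  "D1 M L = (\<lambda>(g, h). differential M (\<lambda>x. L (x, h)) g)"

definition D2 ::
    "('a, 'e::real_normed_vector) manifold \<Rightarrow> ('a \<times> 'a \<Rightarrow> real) \<Rightarrow> 'a \<times> 'a \<Rightarrow> ('a, 'e) tangent_vector \<Rightarrow> real" where
  "D2 M L = (\<lambda>(g, h). differential M (\<lambda>y. L (g, y)) h)"

definition constrained_variations ::
    "'a monoid \<Rightarrow> ('a, 'e::real_normed_vector) manifold \<Rightarrow> nat \<Rightarrow>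
     (nat \<Rightarrow> ('a, 'e) tangent_vector \<Rightarrow> real) \<Rightarrow> nat \<Rightarrow> (nat \<Rightarrow> 'a) \<Rightarrow>
     (nat \<Rightarrow> ('a, 'e) tangent_vector) set" where
  "constrained_variations G M s a N g = {\<delta>.
     (\<forall>k\<le>N. \<delta> k \<in> tangent_space M (g k)) \<and> \<delta> 0 = 0 \<and> \<delta> N = 0 \<and>
     (\<forall>k\<in>{1..<N}. \<forall>j\<in>{1..s}. a j (to_lie_algebra G M (g k) (\<delta> k)) = 0)}"

definition increments :: "'a monoid \<Rightarrow> (nat \<Rightarrow> 'a) \<Rightarrow> nat \<Rightarrow> 'a" where
  "increments G g k = inv\<^bsub>G\<^esub> (g k) \<otimes>\<^bsub>G\<^esub> g (k + 1)"

definition reduced_variation ::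
    "'a monoid \<Rightarrow> ('a, 'e::real_normed_vector) manifold \<Rightarrow> (nat \<Rightarrow> 'a) \<Rightarrow>
     (nat \<Rightarrow> ('a, 'e) tangent_vector) \<Rightarrow> nat \<Rightarrow> ('a, 'e) tangent_vector" where
  "reduced_variation G M g \<delta> k =
     from_lie_algebra G M (increments G g k)
       (to_lie_algebra G M (g (k + 1)) (\<delta> (k + 1)) -
        Ad G M (inv\<^bsub>G\<^esub> (increments G g k)) (to_lie_algebra G M (g k) (\<delta> k)))"

section \<open>The discrete equations of motion\<close>

definition discrete_euler_lagrange ::
    "'a monoid \<Rightarrow> ('a, 'e::real_normed_vector) manifold \<Rightarrow> ('a \<times> 'a \<Rightarrow> real) \<Rightarrow> nat \<Rightarrow>
     (nat \<Rightarrow> ('a, 'e) tangent_vector \<Rightarrow> real) \<Rightarrow> (nat \<Rightarrow> 'a \<Rightarrow> real) \<Rightarrow> nat \<Rightarrow> (nat \<Rightarrow> 'a) \<Rightarrow> bool" where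
  "discrete_euler_lagrange G M L s a f N g \<longleftrightarrow>
     (\<exists>\<mu> :: nat \<Rightarrow> nat \<Rightarrow> real. \<forall>k\<in>{1..<N}. \<forall>v\<in>tangent_space M (g k).
        D1 M L (g k, g (k + 1)) v + D2 M L (g (k - 1), g k) v =
        (\<Sum>j=1..s. \<mu> k j * left_invariant_form G M (a j) (g k) v)) \<and>
     (\<forall>k<N. \<forall>j\<in>{1..s}. f j (inv\<^bsub>G\<^esub> (g k) \<otimes>\<^bsub>G\<^esub> g (k + 1)) = 0)"

definition reduced_discrete_euler_lagrange ::
    "'a monoid \<Rightarrow> ('a, 'e::real_normed_vector) manifold \<Rightarrow> ('a \<Rightarrow> real) \<Rightarrow> nat \<Rightarrow>
     (nat \<Rightarrow> ('a, 'e) tangent_vector \<Rightarrow> real) \<Rightarrow> (nat \<Rightarrow> 'a \<Rightarrow> real) \<Rightarrow> nat \<Rightarrow> (nat \<Rightarrow> 'a) \<Rightarrow> bool" where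
  "reduced_discrete_euler_lagrange G M l s a f N W \<longleftrightarrow>
     (\<exists>\<mu> :: nat \<Rightarrow> nat \<Rightarrow> real. \<forall>k\<in>{1..<N}. \<forall>\<xi>\<in>lie_algebra G M.
        differential M l (W (k - 1)) (from_lie_algebra G M (W (k - 1)) \<xi>) -
        differential M l (W k) (from_lie_algebra G M (W k) (Ad G M (inv\<^bsub>G\<^esub> (W k)) \<xi>)) =
        (\<Sum>j=1..s. \<mu> k j * a j \<xi>)) \<and>
     (\<forall>k<N. \<forall>j\<in>{1..s}. f j (W k) = 0)"

end

theory Submission
  imports Defs
begin

text \<open>
  Along a variation, the derivative of the action sum at time 0 is
  $\sum_k D_1L_d(g_k,g_{k+1})\,\delta g_k + D_2L_d(g_k,g_{k+1})\,\delta g_{k+1}$, and the derivative of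
  the reduced action sum is $\sum_k l_d'(W_k)\,\delta W_k$. Since $L_d(x,y) = l_d(x^{-1}y)$ and
  since the curve $c_k^{-1}c_{k+1}$ has the velocity $\delta W_k$ of the theorem
  (\<open>velocity_increment\<close>), the two derivatives agree summand by summand
  (\<open>D1_D2_eq_reduced\<close>). That formula for the velocity comes from differentiating
  $c_{k+1} = c_k w$ with $w = c_k^{-1}c_{k+1}$ by the product rule and solving for $w'$, so that the
  derivative of the inversion never has to be computed.

  Now write $\xi_k = g_k^{-1}\delta g_k$. Because $\delta g_0 = \delta g_N = 0$, the common value of
  the two derivatives can be regrouped by sites into $\sum_{k=1}^{N-1} \beta_k(\xi_k)$, where
  $\beta_k$ is the linear form on the left-hand side of the reduced equation of motion; it is
  \<open>momentum_balance\<close> below. The vectors $\xi_k$ range independently over the constraint subspace, and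
  every tangent vector is the velocity of a smooth curve (\<open>tangent_vector_curve\<close>), so criticality
  for the action sum and criticality for the reduced one both say that each $\beta_k$ vanishes on
  that subspace. By linear algebra (\<open>vanishing_on_common_kernel\<close>) this means that $\beta_k$ is a linear combination of the $a^j$,
  which is the reduced equation with multipliers. Finally $\beta_k(g_k^{-1}v)$ is the left-hand side of
  the unreduced Euler--Lagrange equation at $v \in T_{g_k}G$, and $v \mapsto g_k^{-1}v$ maps $T_{g_k}G$
  onto the Lie algebra, so the reduced and unreduced equations are equivalent, with the same
  multipliers. The discrete constraint equations coupled with both express the hypothesis
  $(g_k,g_{k+1}) \in \mathcal D_d$.

  For the analysis, differentiability of a map at a single point is enough, and curves, real-valued
  functions and maps of products are all treated as maps between spaces with charts. Everything
  about velocities and tangent maps then follows from one chain rule (\<open>tangent_map_compose\<close>) and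
  one product rule (\<open>tangent_map_product_rule\<close>).
\<close>

section \<open>Differentiable maps between spaces with charts\<close>

text \<open>The part of the manifold structure that the chain rule uses. It passes to products
  and holds for the real line, so curves, functions and maps of two variables can be handled
  uniformly without making products into smooth manifolds.\<close>

locale charted_space =
  fixes M :: "('a, 'e::real_normed_vector) manifold"
  assumes chart_open: "(U, \<phi>) \<in> atlas M \<Longrightarrow> openin (topo M) U"
    and chart_inj: "(U, \<phi>) \<in> atlas M \<Longrightarrow> inj_on \<phi> U"
    and chart_image_open: "(U, \<phi>) \<in> atlas M \<Longrightarrow> open (\<phi> ` U)"
    and chart_inverse_limit:
      "(U, \<phi>) \<in> charts_at M p \<Longrightarrow> limitin (topo M) (inv_into U \<phi>) p (nhds (\<phi> p))"
    and charts_cover: "p \<in> topspace (topo M) \<Longrightarrow> charts_at M p \<noteq> {}"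

text \<open>Differentiability in charts would not by itself give continuity of \<open>F\<close> at \<open>p\<close>, since
  a chart of \<open>N\<close> takes arbitrary values outside its domain. Hence the explicit limit.\<close>

definition differentiable_map ::
    "('a, 'e::real_normed_vector) manifold \<Rightarrow> ('b, 'f::real_normed_vector) manifold \<Rightarrow>
     ('a \<Rightarrow> 'b) \<Rightarrow> 'a \<Rightarrow> bool" where
  "differentiable_map M N F p \<longleftrightarrow> p \<in> topspace (topo M) \<and>
     (\<forall>U \<phi>. (U, \<phi>) \<in> charts_at M p \<longrightarrow>
        limitin (topo N) (\<lambda>x. F (inv_into U \<phi> x)) (F p) (nhds (\<phi> p)) \<and>
        (\<forall>V \<psi>. (V, \<psi>) \<in> charts_at N (F p) \<longrightarrow>
           (\<lambda>x. \<psi> (F (inv_into U \<phi> x))) differentiable (at (\<phi> p))))"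

lemma scaleR_fun_apply: "(r *\<^sub>R f) x = r *\<^sub>R f x"
  by (simp add: scaleR_fun_def)

lemma has_derivative_cong_nhds:
  assumes "(f has_derivative D) (at x)" "\<forall>\<^sub>F y in nhds x. f y = g y"
  shows "(g has_derivative D) (at x)"
proof -
  obtain S where "open S" "x \<in> S" "\<And>y. y \<in> S \<Longrightarrow> f y = g y"
    using assms(2) unfolding eventually_nhds by blast
  with assms(1) show ?thesis
    by (rule has_derivative_transform_within_open)
qed

lemma frechet_derivative_cong_nhds:
  assumes "\<forall>\<^sub>F y in nhds x. f y = g y"
  shows "frechet_derivative f (at x) = frechet_derivative g (at x)"
proof -
  have "\<forall>\<^sub>F y in nhds x. g y = f y"
    using assms by (simp add: eq_commute)
  then have "(f has_derivative D) (at x) \<longleftrightarrow> (g has_derivative D) (at x)" for D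
    using has_derivative_cong_nhds assms by blast
  then show ?thesis
    by (simp add: frechet_derivative_def)
qed

lemma charts_atD: "(U, \<phi>) \<in> charts_at M p \<Longrightarrow> (U, \<phi>) \<in> atlas M \<and> p \<in> U"
  by (simp add: charts_at_def)

context charted_space
begin

lemma chart_inverse: "(U, \<phi>) \<in> charts_at M p \<Longrightarrow> inv_into U \<phi> (\<phi> p) = p"
  by (meson charts_atD chart_inj inv_into_f_f)

lemma eventually_chart_inverse:
  assumes "(U, \<phi>) \<in> charts_at M p" "openin (topo M) S" "p \<in> S"
  shows "\<forall>\<^sub>F x in nhds (\<phi> p). inv_into U \<phi> x \<in> S"
  using chart_inverse_limit[OF assms(1)] assms by (simp add: limitin_def)

lemma some_chart: "p \<in> topspace (topo M) \<Longrightarrow> (SOME c. c \<in> charts_at M p) \<in> charts_at M p"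
  using charts_cover some_in_eq by blast

lemma obtain_some_chart:
  assumes "p \<in> topspace (topo M)"
  obtains U \<phi> where "(SOME c. c \<in> charts_at M p) = (U, \<phi>)" "(U, \<phi>) \<in> charts_at M p"
  using some_chart[OF assms] by (metis surj_pair)

end

lemma differentiable_map_has_derivative:
  assumes "differentiable_map M N F p" "(U, \<phi>) \<in> charts_at M p" "(V, \<psi>) \<in> charts_at N (F p)"
  shows "((\<lambda>x. \<psi> (F (inv_into U \<phi> x))) has_derivative
           frechet_derivative (\<lambda>x. \<psi> (F (inv_into U \<phi> x))) (at (\<phi> p))) (at (\<phi> p))"
  using assms frechet_derivative_works unfolding differentiable_map_def by blast

lemma differentiable_map_limit:
  assumes "differentiable_map M N F p" "(U, \<phi>) \<in> charts_at M p"
  shows "limitin (topo N) (\<lambda>x. F (inv_into U \<phi> x)) (F p) (nhds (\<phi> p))"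
  using assms unfolding differentiable_map_def by blast

lemma differentiable_map_topspace:
  assumes "charted_space M" "differentiable_map M N F p"
  shows "p \<in> topspace (topo M)" "F p \<in> topspace (topo N)"
proof -
  show p: "p \<in> topspace (topo M)"
    using assms unfolding differentiable_map_def by blast
  then show "F p \<in> topspace (topo N)"
    using assms charted_space.obtain_some_chart[OF assms(1) p] differentiable_map_limit limitin_topspace
    by metis
qed

text \<open>Near \<open>p\<close> the continuity of \<open>F\<close> keeps \<open>F x\<close> inside the domain of \<open>\<psi>\<close>, so that \<open>\<psi>\<close> can be inserted
  and cancelled; the rest is the chain rule in the model spaces. The middle chart is arbitrary: with
  the identity in place of \<open>H\<close> this yields the transformation law of tangent vectors.\<close>

lemma chart_chain_rule:
  assumes M: "charted_space M" and N: "charted_space N"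
    and F: "differentiable_map M N F p" and H: "differentiable_map N P H (F p)"
    and c: "(U, \<phi>) \<in> charts_at M p" "(V, \<psi>) \<in> charts_at N (F p)" "(X, \<theta>) \<in> charts_at P (H (F p))"
  shows "((\<lambda>x. \<theta> (H (F (inv_into U \<phi> x)))) has_derivative
          (\<lambda>v. frechet_derivative (\<lambda>y. \<theta> (H (inv_into V \<psi> y))) (at (\<psi> (F p)))
             (frechet_derivative (\<lambda>x. \<psi> (F (inv_into U \<phi> x))) (at (\<phi> p)) v))) (at (\<phi> p))"
proof (rule has_derivative_cong_nhds)
  let ?F = "\<lambda>x. \<psi> (F (inv_into U \<phi> x))" and ?H = "\<lambda>y. \<theta> (H (inv_into V \<psi> y))"
  have "?F (\<phi> p) = \<psi> (F p)"
    using charted_space.chart_inverse[OF M c(1)] by simp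
  then have "((?H \<circ> ?F) has_derivative
       (frechet_derivative ?H (at (\<psi> (F p))) \<circ> frechet_derivative ?F (at (\<phi> p)))) (at (\<phi> p))"
    using diff_chain_at[OF differentiable_map_has_derivative[OF F c(1,2)]]
      differentiable_map_has_derivative[OF H c(2,3)] by simp
  then show "((\<lambda>x. ?H (?F x)) has_derivative
       (\<lambda>v. frechet_derivative ?H (at (\<psi> (F p))) (frechet_derivative ?F (at (\<phi> p)) v))) (at (\<phi> p))"
    by (simp add: o_def)
  have "\<forall>\<^sub>F x in nhds (\<phi> p). F (inv_into U \<phi> x) \<in> V"
    using limitinD[OF differentiable_map_limit[OF F c(1)]] charted_space.chart_open[OF N]
      charts_atD[OF c(2)] by blast
  then show "\<forall>\<^sub>F x in nhds (\<phi> p). ?H (?F x) = \<theta> (H (F (inv_into U \<phi> x)))"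
    by eventually_elim
      (metis charted_space.chart_inj[OF N] charts_atD[OF c(2)] inv_into_f_f)
qed

lemma differentiable_map_compose:
  assumes M: "charted_space M" and N: "charted_space N"
    and F: "differentiable_map M N F p" and H: "differentiable_map N P H (F p)"
  shows "differentiable_map M P (\<lambda>x. H (F x)) p"
  unfolding differentiable_map_def
proof (intro conjI allI impI)
  show "p \<in> topspace (topo M)"
    using F unfolding differentiable_map_def by blast
  fix U \<phi> assume c: "(U, \<phi>) \<in> charts_at M p"
  obtain V \<psi> where d: "(V, \<psi>) \<in> charts_at N (F p)"
    using charted_space.obtain_some_chart[OF N differentiable_map_topspace(2)[OF M F]] by metis
  show "(\<lambda>x. \<theta> (H (F (inv_into U \<phi> x)))) differentiable at (\<phi> p)"
    if "(X, \<theta>) \<in> charts_at P (H (F p))" for X \<theta>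
    using chart_chain_rule[OF M N F H c d that] by (rule differentiableI)
  have "isCont (\<lambda>x. \<psi> (F (inv_into U \<phi> x))) (\<phi> p)"
    using differentiable_map_has_derivative[OF F c d] has_derivative_continuous by blast
  then have lim: "((\<lambda>x. \<psi> (F (inv_into U \<phi> x))) \<longlongrightarrow> \<psi> (F p)) (nhds (\<phi> p))"
    using charted_space.chart_inverse[OF M c]
    by (simp add: continuous_at tendsto_nhds_iff)
  have V: "\<forall>\<^sub>F x in nhds (\<phi> p). F (inv_into U \<phi> x) \<in> V"
    using limitinD[OF differentiable_map_limit[OF F c]] charted_space.chart_open[OF N]
      charts_atD[OF d] by blast
  show "limitin (topo P) (\<lambda>x. H (F (inv_into U \<phi> x))) (H (F p)) (nhds (\<phi> p))"
    unfolding limitin_def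
  proof (intro conjI allI impI)
    show "H (F p) \<in> topspace (topo P)"
      by (rule differentiable_map_topspace(2)[OF N H])
    fix S assume S: "openin (topo P) S \<and> H (F p) \<in> S"
    have "\<forall>\<^sub>F y in nhds (\<psi> (F p)). H (inv_into V \<psi> y) \<in> S"
      using limitinD[OF differentiable_map_limit[OF H d]] S by blast
    then have "\<forall>\<^sub>F x in nhds (\<phi> p). H (inv_into V \<psi> (\<psi> (F (inv_into U \<phi> x)))) \<in> S"
      using lim by (rule eventually_compose_filterlim)
    with V show "\<forall>\<^sub>F x in nhds (\<phi> p). H (F (inv_into U \<phi> x)) \<in> S"
      by eventually_elim
        (metis charted_space.chart_inj[OF N] charts_atD[OF d] inv_into_f_f)
  qed
qed

lemma differentiable_map_cong:
  assumes M: "charted_space M" and F: "differentiable_map M N F p"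
    and S: "openin (topo M) S" "p \<in> S" and eq: "\<And>x. x \<in> S \<Longrightarrow> F x = H x"
  shows "differentiable_map M N H p"
  unfolding differentiable_map_def
proof (intro conjI allI impI)
  show "p \<in> topspace (topo M)"
    using F unfolding differentiable_map_def by blast
  fix U \<phi> assume c: "(U, \<phi>) \<in> charts_at M p"
  have ev: "\<forall>\<^sub>F x in nhds (\<phi> p). F (inv_into U \<phi> x) = H (inv_into U \<phi> x)"
    using charted_space.eventually_chart_inverse[OF M c S] by eventually_elim (rule eq)
  show "limitin (topo N) (\<lambda>x. H (inv_into U \<phi> x)) (H p) (nhds (\<phi> p))"
    using limitin_transform_eventually[OF ev differentiable_map_limit[OF F c]] eq[OF S(2)] by simp
  fix V \<psi> assume "(V, \<psi>) \<in> charts_at N (H p)"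
  then have "(V, \<psi>) \<in> charts_at N (F p)"
    using eq[OF S(2)] by simp
  from differentiable_map_has_derivative[OF F c this]
  show "(\<lambda>x. \<psi> (H (inv_into U \<phi> x))) differentiable at (\<phi> p)"
    by (rule differentiableI[OF has_derivative_cong_nhds]) (use ev in eventually_elim, simp)
qed

lemma tangent_map_cong:
  assumes M: "charted_space M" and p: "p \<in> topspace (topo M)"
    and S: "openin (topo M) S" "p \<in> S" and eq: "\<And>x. x \<in> S \<Longrightarrow> F x = H x"
  shows "tangent_map M N F p = tangent_map M N H p"
proof -
  obtain U \<phi> where c: "(SOME c. c \<in> charts_at M p) = (U, \<phi>)" "(U, \<phi>) \<in> charts_at M p"
    using charted_space.obtain_some_chart[OF M p] by metis
  have ev: "\<forall>\<^sub>F x in nhds (\<phi> p). F (inv_into U \<phi> x) = H (inv_into U \<phi> x)"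
    using charted_space.eventually_chart_inverse[OF M c(2) S] by eventually_elim (rule eq)
  have "frechet_derivative (\<lambda>x. \<psi> (F (inv_into U \<phi> x))) (at (\<phi> p)) =
        frechet_derivative (\<lambda>x. \<psi> (H (inv_into U \<phi> x))) (at (\<phi> p))" for \<psi> :: "'c \<Rightarrow> 'd"
    by (rule frechet_derivative_cong_nhds) (use ev in eventually_elim, simp)
  then show ?thesis
    using eq[OF S(2)] by (simp add: tangent_map_def differential_def c(1) fun_eq_iff)
qed

lemma tangent_map_apply:
  assumes "(SOME c. c \<in> charts_at M p) = (U, \<phi>)" "(V, \<psi>) \<in> charts_at N (F p)"
  shows "tangent_map M N F p v (V, \<psi>) =
    frechet_derivative (\<lambda>x. \<psi> (F (inv_into U \<phi> x))) (at (\<phi> p)) (v (U, \<phi>))"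
  using assms by (simp add: tangent_map_def differential_def)

lemma tangent_map_outside: "c \<notin> charts_at N (F p) \<Longrightarrow> tangent_map M N F p v c = 0"
  by (cases c) (simp add: tangent_map_def)

text \<open>All tangent maps read their argument in the chart that was chosen at its base point, so the chain
  rule in these charts suffices.\<close>

lemma tangent_map_compose:
  assumes M: "charted_space M" and N: "charted_space N"
    and F: "differentiable_map M N F p" and H: "differentiable_map N P H (F p)"
  shows "tangent_map M P (\<lambda>x. H (F x)) p v = tangent_map N P H (F p) (tangent_map M N F p v)"
proof
  fix c :: "('e, 'f) chart"
  obtain X \<theta> where [simp]: "c = (X, \<theta>)" by (cases c)
  obtain U \<phi> where c: "(SOME c. c \<in> charts_at M p) = (U, \<phi>)" "(U, \<phi>) \<in> charts_at M p"
    using charted_space.obtain_some_chart[OF M differentiable_map_topspace(1)[OF M F]] by metis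
  obtain V \<psi> where d: "(SOME c. c \<in> charts_at N (F p)) = (V, \<psi>)" "(V, \<psi>) \<in> charts_at N (F p)"
    using charted_space.obtain_some_chart[OF N differentiable_map_topspace(2)[OF M F]] by metis
  show "tangent_map M P (\<lambda>x. H (F x)) p v c = tangent_map N P H (F p) (tangent_map M N F p v) c"
  proof (cases "c \<in> charts_at P (H (F p))")
    case True
    then show ?thesis
      using frechet_derivative_at[OF chart_chain_rule[OF M N F H c(2) d(2)], of X \<theta>, symmetric]
      by (simp add: tangent_map_apply[OF c(1)] tangent_map_apply[OF d(1)] d(2))
  qed (simp add: tangent_map_outside)
qed

lemma linear_tangent_map:
  assumes M: "charted_space M" and F: "differentiable_map M N F p"
  shows "linear (tangent_map M N F p)"
proof -
  obtain U \<phi> where c: "(SOME c. c \<in> charts_at M p) = (U, \<phi>)" "(U, \<phi>) \<in> charts_at M p"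
    using charted_space.obtain_some_chart[OF M differentiable_map_topspace(1)[OF M F]] by metis
  have lin: "linear (frechet_derivative (\<lambda>x. \<psi> (F (inv_into U \<phi> x))) (at (\<phi> p)))"
    if "(V, \<psi>) \<in> charts_at N (F p)" for V \<psi>
    using differentiable_map_has_derivative[OF F c(2) that] has_derivative_linear by blast
  show ?thesis
  proof (rule linearI; rule ext)
    show "tangent_map M N F p (v + w) d = (tangent_map M N F p v + tangent_map M N F p w) d" for v w d
      by (cases d; cases "d \<in> charts_at N (F p)")
        (simp_all add: tangent_map_apply[OF c(1)] tangent_map_outside linear_add[OF lin])
    show "tangent_map M N F p (r *\<^sub>R v) d = (r *\<^sub>R tangent_map M N F p v) d" for r v d
      by (cases d; cases "d \<in> charts_at N (F p)")
        (simp_all add: tangent_map_apply[OF c(1)] tangent_map_outside linear_scale[OF lin]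
          scaleR_fun_def)
  qed
qed

section \<open>Manifolds, the real line and products as spaces with charts\<close>

lemma is_chart_image_open:
  assumes c: "is_chart T (U, \<phi>)" and O: "openin T S"
  shows "open (\<phi> ` (U \<inter> S))"
proof -
  have U: "open (\<phi> ` U)" and h: "homeomorphic_map (subtopology T U) (top_of_set (\<phi> ` U)) \<phi>"
    using c by (auto simp: is_chart_def)
  have "openin (subtopology T U) (U \<inter> S)"
    using O by (metis inf_commute openin_subtopology)
  then have "openin (top_of_set (\<phi> ` U)) (\<phi> ` (U \<inter> S))"
    using homeomorphic_imp_open_map[OF h] by (simp add: open_map_def)
  then show ?thesis
    using U openin_open_trans by blast
qed

lemma is_chart_inj:
  assumes "is_chart T (U, \<phi>)"
  shows "inj_on \<phi> U"
proof -
  have "topspace (subtopology T U) = U"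
    using assms by (auto simp: is_chart_def dest: openin_subset)
  then show ?thesis
    using assms homeomorphic_imp_injective_map by (fastforce simp: is_chart_def)
qed

lemma (in smooth_manifold) charted_space: "charted_space M"
proof
  show "charts_at M p \<noteq> {}" if "p \<in> topspace (topo M)" for p
    using that cover by (auto simp: charts_at_def)
  fix U \<phi>
  show "openin (topo M) U" "inj_on \<phi> U" "open (\<phi> ` U)" if "(U, \<phi>) \<in> atlas M"
    using charts[OF that] is_chart_inj by (auto simp: is_chart_def)
  show "limitin (topo M) (inv_into U \<phi>) p (nhds (\<phi> p))" if c: "(U, \<phi>) \<in> charts_at M p" for p
    unfolding limitin_def
  proof (intro conjI allI impI)
    have chart: "is_chart (topo M) (U, \<phi>)" and p: "p \<in> U"
      using charts charts_atD[OF c] by auto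
    then show "p \<in> topspace (topo M)"
      by (auto simp: is_chart_def dest: openin_subset)
    fix S assume S: "openin (topo M) S \<and> p \<in> S"
    show "\<forall>\<^sub>F x in nhds (\<phi> p). inv_into U \<phi> x \<in> S"
      unfolding eventually_nhds
    proof (intro exI conjI ballI)
      show "open (\<phi> ` (U \<inter> S))"
        using is_chart_image_open[OF chart] S by blast
      show "\<phi> p \<in> \<phi> ` (U \<inter> S)" using p S by blast
      show "inv_into U \<phi> x \<in> S" if "x \<in> \<phi> ` (U \<inter> S)" for x
        using that is_chart_inj[OF chart] by (auto simp: inv_into_f_f)
    qed
  qed
qed

lemma inv_into_id: "x \<in> S \<Longrightarrow> inv_into S id x = x"
  by (metis id_apply inj_on_id inv_into_f_f)

lemma charts_at_open_manifold: "p \<in> S \<Longrightarrow> charts_at (open_manifold S) p = {(S, id)}"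
  by (auto simp: charts_at_def open_manifold_def)

lemma charted_space_open_manifold:
  fixes S :: "'e::real_normed_vector set"
  assumes "open S"
  shows "charted_space (open_manifold S)"
proof
  show "charts_at (open_manifold S) p \<noteq> {}" if "p \<in> topspace (topo (open_manifold S))" for p
    using that by (auto simp: charts_at_def open_manifold_def)
  fix U :: "'e set" and \<phi> :: "'e \<Rightarrow> 'e"
  show "openin (topo (open_manifold S)) U" "inj_on \<phi> U" "open (\<phi> ` U)"
    if "(U, \<phi>) \<in> atlas (open_manifold S)"
    using that assms by (auto simp: open_manifold_def)
  show "limitin (topo (open_manifold S)) (inv_into U \<phi>) p (nhds (\<phi> p))"
    if "(U, \<phi>) \<in> charts_at (open_manifold S) p" for p
  proof -
    from that have [simp]: "U = S" "\<phi> = id" and p: "p \<in> S"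
      by (auto simp: charts_at_def open_manifold_def)
    have "\<forall>\<^sub>F x in nhds p. x \<in> S"
      using assms p by (simp add: eventually_nhds_in_open)
    moreover from this have "\<forall>\<^sub>F x in nhds p. x = inv_into S id x"
      by eventually_elim (simp add: inv_into_id)
    moreover from calculation have "limitin (top_of_set S) (\<lambda>x. x) p (nhds p)"
      using p by (simp add: limitin_subtopology filterlim_ident)
    ultimately show ?thesis
      using limitin_transform_eventually by (fastforce simp: open_manifold_def)
  qed
qed

lemma charts_at_prod_manifold:
  "charts_at (prod_manifold M N) (p, q) =
     {(U \<times> V, map_prod \<phi> \<psi>) | U \<phi> V \<psi>. (U, \<phi>) \<in> charts_at M p \<and> (V, \<psi>) \<in> charts_at N q}"
  unfolding charts_at_def prod_manifold_def by (auto; blast)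

lemma inv_into_map_prod:
  assumes "inj_on \<phi> U" "inj_on \<psi> V" "x \<in> \<phi> ` U" "y \<in> \<psi> ` V"
  shows "inv_into (U \<times> V) (map_prod \<phi> \<psi>) (x, y) = (inv_into U \<phi> x, inv_into V \<psi> y)"
proof -
  obtain a b where "x = \<phi> a" "y = \<psi> b" "a \<in> U" "b \<in> V"
    using assms(3,4) by blast
  then show ?thesis
    using inv_into_f_f[OF map_prod_inj_on[OF assms(1,2)], of "(a, b)"] assms(1,2)
    by simp
qed

lemma charted_space_prod_manifold:
  fixes M :: "('a, 'e::real_normed_vector) manifold" and N :: "('b, 'f::real_normed_vector) manifold"
  assumes M: "charted_space M" and N: "charted_space N"
  shows "charted_space (prod_manifold M N)"
proof
  show "charts_at (prod_manifold M N) p \<noteq> {}" if "p \<in> topspace (topo (prod_manifold M N))" for p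
  proof -
    obtain a b where p: "p = (a, b)" by (cases p)
    then have "charts_at M a \<noteq> {}" "charts_at N b \<noteq> {}"
      using that charted_space.charts_cover[OF M] charted_space.charts_cover[OF N]
      by (auto simp: prod_manifold_def)
    then show ?thesis
      by (auto simp: p charts_at_prod_manifold)
  qed
  fix X :: "('a \<times> 'b) set" and \<theta> :: "'a \<times> 'b \<Rightarrow> 'e \<times> 'f"
  show "openin (topo (prod_manifold M N)) X" "inj_on \<theta> X" "open (\<theta> ` X)"
    if c: "(X, \<theta>) \<in> atlas (prod_manifold M N)"
  proof -
    obtain U \<phi> V \<psi> where [simp]: "X = U \<times> V" "\<theta> = map_prod \<phi> \<psi>"
      and c: "(U, \<phi>) \<in> atlas M" "(V, \<psi>) \<in> atlas N"
      using c by (auto simp: prod_manifold_def)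
    note M' = charted_space.chart_open[OF M c(1)] charted_space.chart_inj[OF M c(1)]
      charted_space.chart_image_open[OF M c(1)]
    note N' = charted_space.chart_open[OF N c(2)] charted_space.chart_inj[OF N c(2)]
      charted_space.chart_image_open[OF N c(2)]
    show "openin (topo (prod_manifold M N)) X"
      using M'(1) N'(1) by (simp add: prod_manifold_def openin_prod_Times_iff)
    show "inj_on \<theta> X"
      using map_prod_inj_on[OF M'(2) N'(2)] by simp
    show "open (\<theta> ` X)"
      using M'(3) N'(3) by (simp add: map_prod_surj_on[OF refl refl] open_Times)
  qed
  show "limitin (topo (prod_manifold M N)) (inv_into X \<theta>) p (nhds (\<theta> p))"
    if c: "(X, \<theta>) \<in> charts_at (prod_manifold M N) p" for p
  proof -
    obtain a b where p [simp]: "p = (a, b)" by (cases p)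
    obtain U \<phi> V \<psi> where [simp]: "X = U \<times> V" "\<theta> = map_prod \<phi> \<psi>"
      and c: "(U, \<phi>) \<in> charts_at M a" "(V, \<psi>) \<in> charts_at N b"
      using c by (auto simp: charts_at_prod_manifold)
    note U = charts_atD[OF c(1)] and V = charts_atD[OF c(2)]
    have "\<forall>\<^sub>F z in nhds (\<phi> a, \<psi> b). z \<in> (\<phi> ` U) \<times> (\<psi> ` V)"
      using U V charted_space.chart_image_open[OF M] charted_space.chart_image_open[OF N]
      by (intro eventually_nhds_in_open open_Times) auto
    then have "\<forall>\<^sub>F z in nhds (\<phi> a, \<psi> b).
        (inv_into U \<phi> (fst z), inv_into V \<psi> (snd z)) = inv_into (U \<times> V) (map_prod \<phi> \<psi>) z"
      by eventually_elim
        (use charted_space.chart_inj[OF M] charted_space.chart_inj[OF N] U V in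
          \<open>auto simp: inv_into_map_prod\<close>)
    moreover have "limitin (prod_topology (topo M) (topo N))
        (\<lambda>z. (inv_into U \<phi> (fst z), inv_into V \<psi> (snd z))) (a, b) (nhds (\<phi> a, \<psi> b))"
    proof -
      have f: "filterlim fst (nhds (\<phi> a)) (nhds (\<phi> a, \<psi> b))"
        and s: "filterlim snd (nhds (\<psi> b)) (nhds (\<phi> a, \<psi> b))"
        using tendsto_fst[OF filterlim_ident[of "nhds (\<phi> a, \<psi> b)"]]
          tendsto_snd[OF filterlim_ident[of "nhds (\<phi> a, \<psi> b)"]] by simp_all
      show ?thesis
        using charted_space.chart_inverse_limit[OF M c(1)] charted_space.chart_inverse_limit[OF N c(2)]
        unfolding limitin_pairwise
        by (auto simp: limitin_def o_def intro!: eventually_compose_filterlim[OF _ f]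
            eventually_compose_filterlim[OF _ s])
    qed
    ultimately show ?thesis
      using limitin_transform_eventually by (fastforce simp: prod_manifold_def)
  qed
qed

lemma Ck_on_1_differentiable:
  assumes "Ck_on (Suc k) f S" "x \<in> S"
  shows "f differentiable (at x)"
  using assms by (auto simp: differentiable_def)

lemma smooth_on_differentiable: "smooth_on f S \<Longrightarrow> x \<in> S \<Longrightarrow> f differentiable (at x)"
  unfolding smooth_on_def using Ck_on_1_differentiable by blast

lemma smooth_map_differentiable:
  assumes M: "charted_space M" and F: "smooth_map M N F" and p: "p \<in> topspace (topo M)"
  shows "differentiable_map M N F p"
  unfolding differentiable_map_def
proof (intro conjI allI impI)
  show "p \<in> topspace (topo M)" by (rule p)
  fix U \<phi> assume c: "(U, \<phi>) \<in> charts_at M p"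
  have "continuous_map (topo M) (topo N) F"
    using F by (simp add: smooth_map_def)
  from continuous_map_limit[OF this charted_space.chart_inverse_limit[OF M c]]
  show "limitin (topo N) (\<lambda>x. F (inv_into U \<phi> x)) (F p) (nhds (\<phi> p))"
    by (simp add: o_def)
  fix V \<psi> assume d: "(V, \<psi>) \<in> charts_at N (F p)"
  then have "smooth_on (\<lambda>x. \<psi> (F (inv_into U \<phi> x))) (\<phi> ` (U \<inter> F -` V))"
    using F charts_atD[OF c] charts_atD[OF d] by (fastforce simp: smooth_map_def)
  then show "(\<lambda>x. \<psi> (F (inv_into U \<phi> x))) differentiable at (\<phi> p)"
    using charts_atD[OF c] charts_atD[OF d] by (intro smooth_on_differentiable) auto
qed

lemma differentiable_map_const:
  assumes "p \<in> topspace (topo M)" "q \<in> topspace (topo N)"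
  shows "differentiable_map M N (\<lambda>_. q) p"
  using assms by (simp add: differentiable_map_def)

lemma tangent_map_const: "tangent_map M N (\<lambda>_. q) p v = 0"
  by (auto simp: tangent_map_def differential_def fun_eq_iff split: prod.splits)

section \<open>Tangent spaces\<close>

lemma tangent_space_iff:
  "v \<in> tangent_space M p \<longleftrightarrow>
     (\<forall>U \<phi> V \<psi>. (U, \<phi>) \<in> charts_at M p \<longrightarrow> (V, \<psi>) \<in> charts_at M p \<longrightarrow>
        v (V, \<psi>) = frechet_derivative (\<lambda>x. \<psi> (inv_into U \<phi> x)) (at (\<phi> p)) (v (U, \<phi>))) \<and>
     (\<forall>c. c \<notin> charts_at M p \<longrightarrow> v c = 0)"
  by (simp add: tangent_space_def Ball_def split_paired_All)

lemma tangent_space_transition: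
  assumes "v \<in> tangent_space M p" "(U, \<phi>) \<in> charts_at M p" "(V, \<psi>) \<in> charts_at M p"
  shows "frechet_derivative (\<lambda>x. \<psi> (inv_into U \<phi> x)) (at (\<phi> p)) (v (U, \<phi>)) = v (V, \<psi>)"
  using assms unfolding tangent_space_iff by metis

lemma tangent_space_outside: "v \<in> tangent_space M p \<Longrightarrow> c \<notin> charts_at M p \<Longrightarrow> v c = 0"
  unfolding tangent_space_iff by blast

context smooth_manifold
begin

lemma transition_differentiable:
  assumes "(U, \<phi>) \<in> charts_at M p" "(V, \<psi>) \<in> charts_at M p"
  shows "(\<lambda>x. \<psi> (inv_into U \<phi> x)) differentiable at (\<phi> p)"
proof -
  have "smooth_on (\<lambda>x. \<psi> (inv_into U \<phi> x)) (\<phi> ` (U \<inter> V))"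
    using transitions[of "(U, \<phi>)" "(V, \<psi>)"] charts_atD[OF assms(1)] charts_atD[OF assms(2)]
    by (simp add: smooth_transition_def)
  then show ?thesis
    using charts_atD[OF assms(1)] charts_atD[OF assms(2)] by (intro smooth_on_differentiable) auto
qed

lemma differentiable_map_id: "p \<in> topspace (topo M) \<Longrightarrow> differentiable_map M M (\<lambda>x. x) p"
  using charted_space.chart_inverse_limit[OF charted_space] transition_differentiable
  by (simp add: differentiable_map_def)

lemma tangent_map_id:
  assumes p: "p \<in> topspace (topo M)" and v: "v \<in> tangent_space M p"
  shows "tangent_map M M (\<lambda>x. x) p v = v"
proof
  fix c :: "('a, 'e) chart"
  obtain V \<psi> where [simp]: "c = (V, \<psi>)" by (cases c)
  obtain U \<phi> where d: "(SOME c. c \<in> charts_at M p) = (U, \<phi>)" "(U, \<phi>) \<in> charts_at M p"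
    using charted_space.obtain_some_chart[OF charted_space p] by metis
  show "tangent_map M M (\<lambda>x. x) p v c = v c"
  proof (cases "c \<in> charts_at M p")
    case True
    then show ?thesis
      using tangent_space_transition[OF v d(2)] by (simp add: tangent_map_apply[OF d(1)])
  next
    case False
    then show ?thesis
      using v by (simp add: tangent_map_outside tangent_space_outside)
  qed
qed

text \<open>The components of the image transform correctly because a change of chart in the target is the
  chain rule with the identity map.\<close>

lemma tangent_map_in_tangent_space:
  fixes Q :: "('q, 'r::real_normed_vector) manifold"
  assumes Q: "charted_space Q" and F: "differentiable_map Q M F r"
  shows "tangent_map Q M F r v \<in> tangent_space M (F r)"
proof -
  obtain X \<theta> where c: "(SOME c. c \<in> charts_at Q r) = (X, \<theta>)" "(X, \<theta>) \<in> charts_at Q r"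
    using charted_space.obtain_some_chart[OF Q differentiable_map_topspace(1)[OF Q F]] by metis
  have id: "differentiable_map M M (\<lambda>x. x) (F r)"
    using differentiable_map_id differentiable_map_topspace[OF Q F] by blast
  have trans: "tangent_map Q M F r v (V, \<psi>) =
      frechet_derivative (\<lambda>x. \<psi> (inv_into U \<phi> x)) (at (\<phi> (F r))) (tangent_map Q M F r v (U, \<phi>))"
    if "(U, \<phi>) \<in> charts_at M (F r)" "(V, \<psi>) \<in> charts_at M (F r)" for U \<phi> V \<psi>
    using frechet_derivative_at[OF chart_chain_rule[OF Q charted_space F id c(2) that], symmetric] that
    by (simp add: tangent_map_apply[OF c(1)])
  show ?thesis
    unfolding tangent_space_iff
    by (intro conjI allI impI) (rule trans tangent_map_outside, assumption+)+
qed

lemma subspace_tangent_space: "subspace (tangent_space M p)"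
proof (rule subspaceI)
  have lin: "linear (frechet_derivative (\<lambda>x. \<psi> (inv_into U \<phi> x)) (at (\<phi> p)))"
    if "(U, \<phi>) \<in> charts_at M p" "(V, \<psi>) \<in> charts_at M p" for U \<phi> V \<psi>
    using transition_differentiable[OF that] linear_frechet_derivative by blast
  show "0 \<in> tangent_space M p"
    using linear_0[OF lin] by (simp add: tangent_space_iff)
  fix v assume v: "v \<in> tangent_space M p"
  show "r *\<^sub>R v \<in> tangent_space M p" for r
    unfolding tangent_space_iff
    by (simp add: linear_scale[OF lin] tangent_space_transition[OF v] tangent_space_outside[OF v]
        scaleR_fun_def)
  fix w assume w: "w \<in> tangent_space M p"
  show "v + w \<in> tangent_space M p"
    unfolding tangent_space_iff
    by (simp add: linear_add[OF lin] tangent_space_transition[OF v] tangent_space_transition[OF w]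
        tangent_space_outside[OF v] tangent_space_outside[OF w])
qed

end

section \<open>The product rule\<close>

lemma has_derivative_pair_component:
  assumes Q: "charted_space Q" 
    and A: "differentiable_map Q M A r" and B: "differentiable_map Q N B r"
    and c: "(X, \<theta>) \<in> charts_at Q r" "(U, \<phi>) \<in> charts_at M (A r)" "(V, \<psi>) \<in> charts_at N (B r)"
  shows "((\<lambda>x. map_prod \<phi> \<psi> (A (inv_into X \<theta> x), B (inv_into X \<theta> x))) has_derivative
     (\<lambda>h. (frechet_derivative (\<lambda>x. \<phi> (A (inv_into X \<theta> x))) (at (\<theta> r)) h,
           frechet_derivative (\<lambda>x. \<psi> (B (inv_into X \<theta> x))) (at (\<theta> r)) h))) (at (\<theta> r))"
  using has_derivative_Pair[OF differentiable_map_has_derivative[OF A c(1,2)]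
      differentiable_map_has_derivative[OF B c(1,3)]] by simp

lemma differentiable_map_Pair:
  assumes Q: "charted_space Q" 
    and A: "differentiable_map Q M A r" and B: "differentiable_map Q N B r"
  shows "differentiable_map Q (prod_manifold M N) (\<lambda>z. (A z, B z)) r"
  unfolding differentiable_map_def
proof (intro conjI allI impI)
  show "r \<in> topspace (topo Q)"
    by (rule differentiable_map_topspace(1)[OF Q A])
  fix X \<theta> assume c: "(X, \<theta>) \<in> charts_at Q r"
  show "limitin (topo (prod_manifold M N)) (\<lambda>x. (A (inv_into X \<theta> x), B (inv_into X \<theta> x)))
      (A r, B r) (nhds (\<theta> r))"
    using differentiable_map_limit[OF A c] differentiable_map_limit[OF B c]
    by (simp add: prod_manifold_def limitin_pairwise o_def)
  fix Y \<eta> assume "(Y, \<eta>) \<in> charts_at (prod_manifold M N) (A r, B r)"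
  then obtain U \<phi> V \<psi> where [simp]: "\<eta> = map_prod \<phi> \<psi>"
      and d: "(U, \<phi>) \<in> charts_at M (A r)" "(V, \<psi>) \<in> charts_at N (B r)"
    by (auto simp: charts_at_prod_manifold)
  show "(\<lambda>x. \<eta> (A (inv_into X \<theta> x), B (inv_into X \<theta> x))) differentiable at (\<theta> r)"
    using has_derivative_pair_component[OF Q A B c d] by (auto intro: differentiableI)
qed

lemma tangent_map_Pair_apply:
  assumes Q: "charted_space Q" 
    and A: "differentiable_map Q M A r" and B: "differentiable_map Q N B r"
    and c: "(U, \<phi>) \<in> charts_at M (A r)" "(V, \<psi>) \<in> charts_at N (B r)"
  shows "tangent_map Q (prod_manifold M N) (\<lambda>z. (A z, B z)) r v (U \<times> V, map_prod \<phi> \<psi>) =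
     (tangent_map Q M A r v (U, \<phi>), tangent_map Q N B r v (V, \<psi>))"
proof -
  obtain X \<theta> where d: "(SOME c. c \<in> charts_at Q r) = (X, \<theta>)" "(X, \<theta>) \<in> charts_at Q r"
    using charted_space.obtain_some_chart[OF Q differentiable_map_topspace(1)[OF Q A]] by metis
  have e: "(U \<times> V, map_prod \<phi> \<psi>) \<in> charts_at (prod_manifold M N) (A r, B r)"
    using c by (auto simp: charts_at_prod_manifold)
  show ?thesis
    unfolding tangent_map_apply[where F="\<lambda>z. (A z, B z)", OF d(1) e] tangent_map_apply[where F=A, OF d(1) c(1)]
      tangent_map_apply[where F=B, OF d(1) c(2)]
      frechet_derivative_at[OF has_derivative_pair_component[OF Q A B d(2) c], symmetric] ..
qed

text \<open>The tangent vector of \<open>z \<mapsto> (A z, B z)\<close> is the sum of the images of its two components under the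
  slice inclusions \<open>x \<mapsto> (x, B r)\<close> and \<open>y \<mapsto> (A r, y)\<close>; the linear tangent map of \<open>F\<close> carries this
  sum to the sum of the two partial tangent maps.\<close>

lemma tangent_map_product_rule:
  assumes M: "smooth_manifold M" and N: "smooth_manifold N" and Q: "charted_space Q"
    and A: "differentiable_map Q M A r" and B: "differentiable_map Q N B r"
    and F: "differentiable_map (prod_manifold M N) P F (A r, B r)"
  shows "tangent_map Q P (\<lambda>z. F (A z, B z)) r v =
     tangent_map M P (\<lambda>x. F (x, B r)) (A r) (tangent_map Q M A r v) +
     tangent_map N P (\<lambda>y. F (A r, y)) (B r) (tangent_map Q N B r v)"
proof -
  note M' = smooth_manifold.charted_space[OF M] and N' = smooth_manifold.charted_space[OF N]
  note MN = charted_space_prod_manifold[OF M' N']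
  note p = differentiable_map_topspace(2)[OF Q A] and q = differentiable_map_topspace(2)[OF Q B]
  let ?u = "tangent_map Q M A r v" and ?w = "tangent_map Q N B r v"
  have u: "tangent_map M M (\<lambda>x. x) (A r) ?u = ?u"
    by (intro smooth_manifold.tangent_map_id[OF M] smooth_manifold.tangent_map_in_tangent_space[OF M]
        p A Q)
  have w: "tangent_map N N (\<lambda>x. x) (B r) ?w = ?w"
    by (intro smooth_manifold.tangent_map_id[OF N] smooth_manifold.tangent_map_in_tangent_space[OF N]
        q B Q)
  note idM = smooth_manifold.differentiable_map_id[OF M p]
  note idN = smooth_manifold.differentiable_map_id[OF N q]
  note cM = differentiable_map_const[of "A r" M "B r" N, OF p q]
  note cN = differentiable_map_const[of "B r" N "A r" M, OF q p]
  \<comment> \<open>in a product chart the first vector has components (u, 0), the second (0, w)\<close>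
  let ?S1 = "tangent_map M (prod_manifold M N) (\<lambda>x. (x, B r)) (A r) ?u"
  let ?S2 = "tangent_map N (prod_manifold M N) (\<lambda>y. (A r, y)) (B r) ?w"
  have split: "tangent_map Q (prod_manifold M N) (\<lambda>z. (A z, B z)) r v = ?S1 + ?S2"
  proof
    fix c :: "('a \<times> 'c, 'b \<times> 'd) chart"
    show "tangent_map Q (prod_manifold M N) (\<lambda>z. (A z, B z)) r v c = (?S1 + ?S2) c"
    proof (cases "c \<in> charts_at (prod_manifold M N) (A r, B r)")
      case True
      then obtain U \<phi> V \<psi> where [simp]: "c = (U \<times> V, map_prod \<phi> \<psi>)"
        and d: "(U, \<phi>) \<in> charts_at M (A r)" "(V, \<psi>) \<in> charts_at N (B r)"
        by (auto simp: charts_at_prod_manifold)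
      show ?thesis
        by (simp add: tangent_map_Pair_apply[OF Q A B d] tangent_map_Pair_apply[OF M' idM cM d]
            tangent_map_Pair_apply[OF N' cN idN d] u w tangent_map_const)
    qed (simp add: tangent_map_outside)
  qed
  have "tangent_map Q P (\<lambda>z. F (A z, B z)) r v = tangent_map (prod_manifold M N) P F (A r, B r) (?S1 + ?S2)"
    using tangent_map_compose[OF Q MN differentiable_map_Pair[OF Q A B] F, of v] split by simp
  also have "\<dots> = tangent_map (prod_manifold M N) P F (A r, B r) ?S1 +
      tangent_map (prod_manifold M N) P F (A r, B r) ?S2"
    by (rule linear_add[OF linear_tangent_map[OF MN F]])
  finally show ?thesis
    using tangent_map_compose[OF M' MN differentiable_map_Pair[OF M' idM cM] F, of ?u]
      tangent_map_compose[OF N' MN differentiable_map_Pair[OF N' cN idN] F, of ?w] by simp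
qed

section \<open>Curves\<close>

abbreviation real_line :: "(real, real) manifold" where
  "real_line \<equiv> open_manifold UNIV"

lemma charted_space_real_line: "charted_space real_line"
  by (rule charted_space_open_manifold) simp

lemma some_chart_real_line: "(SOME c. c \<in> charts_at (real_line) p) = (UNIV, id)"
  by (simp add: charts_at_open_manifold)

lemma inv_into_UNIV_id: "inv_into UNIV id = (\<lambda>x. x)"
  by (simp add: fun_eq_iff inv_into_id)

lemma differentiable_curve_iff:
  "differentiable_map real_line M c t \<longleftrightarrow> limitin (topo M) c (c t) (nhds t) \<and>
     (\<forall>U \<phi>. (U, \<phi>) \<in> charts_at M (c t) \<longrightarrow> (\<lambda>x. \<phi> (c x)) differentiable (at t))"
  by (simp add: differentiable_map_def charts_at_open_manifold inv_into_UNIV_id)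
    (simp add: open_manifold_def)

text \<open>The tangent vector \<open>\<lambda>_. 1\<close> of the real line has component 1 in its only chart; the tangent
  map does not evaluate it in any other chart.\<close>

lemma velocity_eq_tangent_map:
  assumes "differentiable_map real_line M c 0"
  shows "velocity M c = tangent_map real_line M c 0 (\<lambda>_. 1)"
proof
  fix d :: "('a, 'b) chart"
  obtain U \<phi> where [simp]: "d = (U, \<phi>)" by (cases d)
  show "velocity M c d = tangent_map real_line M c 0 (\<lambda>_. 1) d"
  proof (cases "d \<in> charts_at M (c 0)")
    case True
    then have "(\<lambda>x. \<phi> (c x)) differentiable (at 0)"
      using assms by (simp add: differentiable_curve_iff)
    from frechet_derivative_eq_vector_derivative[OF this] True show ?thesis
      by (simp add: tangent_map_apply[OF some_chart_real_line] velocity_def inv_into_UNIV_id)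
  qed (simp add: tangent_map_outside, simp add: velocity_def)
qed

lemma tangent_map_real_line: "tangent_map M real_line F p v (UNIV, id) = differential M F p v"
  by (simp add: tangent_map_def charts_at_open_manifold)

lemma has_real_derivative_tangent_map:
  assumes "differentiable_map real_line real_line f 0"
  shows "(f has_real_derivative tangent_map real_line real_line f 0 (\<lambda>_. 1) (UNIV, id)) (at 0)"
proof -
  have "f differentiable (at 0)"
    using assms by (simp add: differentiable_curve_iff charts_at_open_manifold)
  then show ?thesis
    using vector_derivative_works[of f "at 0"]
    by (simp add: has_real_derivative_iff_has_vector_derivative tangent_map_real_line differential_def
        some_chart_real_line inv_into_UNIV_id frechet_derivative_eq_vector_derivative)
qed

lemma has_real_derivative_along_curve:
  assumes M: "charted_space M" and c: "differentiable_map real_line M c 0"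
    and F: "differentiable_map M real_line F (c 0)"
  shows "((\<lambda>t. F (c t)) has_real_derivative differential M F (c 0) (velocity M c)) (at 0)"
  using has_real_derivative_tangent_map[OF differentiable_map_compose[OF charted_space_real_line M c F]]
  by (simp add: tangent_map_compose[OF charted_space_real_line M c F] velocity_eq_tangent_map[OF c]
      tangent_map_real_line)

lemma has_real_derivative_along_curves:
  assumes M: "smooth_manifold M" and N: "smooth_manifold N"
    and c: "differentiable_map real_line M c 0" and d: "differentiable_map real_line N d 0"
    and F: "differentiable_map (prod_manifold M N) real_line F (c 0, d 0)"
  shows "((\<lambda>t. F (c t, d t)) has_real_derivative
     differential M (\<lambda>x. F (x, d 0)) (c 0) (velocity M c) +
     differential N (\<lambda>y. F (c 0, y)) (d 0) (velocity N d)) (at 0)"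
proof -
  have "charted_space (prod_manifold M N)"
    by (intro charted_space_prod_manifold smooth_manifold.charted_space M N)
  from differentiable_map_compose[OF charted_space_real_line this
      differentiable_map_Pair[OF charted_space_real_line c d] F]
  show ?thesis
    by (auto dest!: has_real_derivative_tangent_map
        simp: tangent_map_product_rule[OF M N charted_space_real_line c d F]
        velocity_eq_tangent_map[OF c] velocity_eq_tangent_map[OF d] tangent_map_real_line)
qed

lemma smooth_curve_differentiable:
  assumes M: "charted_space M" and c: "smooth_curve M c"
  shows "differentiable_map real_line M c 0"
proof -
  obtain \<epsilon> :: real where e: "\<epsilon> > 0" and s: "smooth_map (open_manifold {-\<epsilon><..<\<epsilon>}) M c"
    using c by (auto simp: smooth_curve_def)
  have d: "differentiable_map (open_manifold {-\<epsilon><..<\<epsilon>}) M c 0"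
    by (rule smooth_map_differentiable[OF charted_space_open_manifold s])
      (use e in \<open>auto simp: open_manifold_def\<close>)
  have at0: "({-\<epsilon><..<\<epsilon>}, id) \<in> charts_at (open_manifold {-\<epsilon><..<\<epsilon>}) 0"
    using e by (simp add: charts_at_open_manifold)
  have "\<forall>\<^sub>F t in nhds (0::real). t \<in> {-\<epsilon><..<\<epsilon>}"
    using e by (intro eventually_nhds_in_open) auto
  then have ev: "\<forall>\<^sub>F t in nhds 0. c (inv_into {-\<epsilon><..<\<epsilon>} id t) = c t"
    by eventually_elim (simp add: inv_into_id)
  show ?thesis
    unfolding differentiable_curve_iff
  proof (intro conjI allI impI)
    show "limitin (topo M) c (c 0) (nhds 0)"
      using limitin_transform_eventually[OF ev] differentiable_map_limit[OF d at0] by simp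
    fix U \<phi> assume "(U, \<phi>) \<in> charts_at M (c 0)"
    from differentiable_map_has_derivative[OF d at0 this]
    show "(\<lambda>t. \<phi> (c t)) differentiable at 0"
      by (intro differentiableI[OF has_derivative_cong_nhds], simp) (use ev in eventually_elim, simp)
  qed
qed

text \<open>Composition with a line is a case of the chain rule of order \<open>k\<close> in which a direct
  induction works: differentiating along the line stays within the functions \<open>x \<mapsto> f' x v\<close>
  restricted to the same line.\<close>

lemma Ck_on_affine_line:
  assumes "Ck_on k f S" "open S" 
  shows "Ck_on k (\<lambda>t::real. f (x + t *\<^sub>R w)) {t. x + t *\<^sub>R w \<in> S}"
  using assms(1)
proof (induction k arbitrary: f)
  case 0
  then show ?case
    by (auto intro!: continuous_intros continuous_on_compose2[of S f])
next
  case (Suc k)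
  then obtain f' where f': "\<And>x. x \<in> S \<Longrightarrow> (f has_derivative f' x) (at x)"
    and Ck: "\<And>v. Ck_on k (\<lambda>x. f' x v) S"
    by auto
  show ?case
    unfolding Ck_on.simps
  proof (intro exI conjI ballI allI)
    show "((\<lambda>t. f (x + t *\<^sub>R w)) has_derivative (\<lambda>h. f' (x + t *\<^sub>R w) (h *\<^sub>R w))) (at t)"
      if "t \<in> {t. x + t *\<^sub>R w \<in> S}" for t
    proof -
      have "((\<lambda>t. x + t *\<^sub>R w) has_derivative (\<lambda>h. h *\<^sub>R w)) (at t)"
        by (auto intro!: derivative_eq_intros)
      from diff_chain_at[OF this f'] that show ?thesis
        by (simp add: o_def)
    qed
    show "Ck_on k (\<lambda>t. f' (x + t *\<^sub>R w) (h *\<^sub>R w)) {t. x + t *\<^sub>R w \<in> S}" for h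
      by (rule Suc.IH[OF Ck])
  qed
qed

lemma Ck_on_cong:
  assumes "Ck_on k f S" "open S" "\<And>x. x \<in> S \<Longrightarrow> f x = g x"
  shows "Ck_on k g S"
proof (cases k)
  case 0
  then show ?thesis
    using assms by (simp cong: continuous_on_cong)
next
  case (Suc m)
  then obtain f' where f': "\<And>x. x \<in> S \<Longrightarrow> (f has_derivative f' x) (at x)"
    and Ck: "\<And>v. Ck_on m (\<lambda>x. f' x v) S"
    using assms(1) by auto
  have "(g has_derivative f' x) (at x)" if "x \<in> S" for x
    using has_derivative_transform_within_open[OF f'[OF that] assms(2) that assms(3)] by blast
  then show ?thesis
    using Suc Ck by auto
qed

lemma Ck_on_subset: "Ck_on k f S \<Longrightarrow> T \<subseteq> S \<Longrightarrow> Ck_on k f T"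
proof (induction k arbitrary: f)
  case 0
  then show ?case
    by (auto intro: continuous_on_subset)
next
  case (Suc k)
  then obtain f' where "\<And>x. x \<in> S \<Longrightarrow> (f has_derivative f' x) (at x)"
    and Ck: "\<And>v. Ck_on k (\<lambda>x. f' x v) S"
    by auto
  with Suc.prems(2) have "\<forall>x\<in>T. (f has_derivative f' x) (at x)"
    by blast
  then show ?case
    using Suc.IH[OF Ck Suc.prems(2)] by auto
qed

text \<open>The curve is a straight line in a chart; its velocity has the right component in that
  chart, and the components in all other charts are then forced by the transformation law.\<close>

lemma (in smooth_manifold) tangent_vector_curve:
  assumes p: "p \<in> topspace (topo M)" and v: "v \<in> tangent_space M p"
  obtains c where "smooth_curve M c" "c 0 = p" "velocity M c = v"
proof -
  obtain U \<phi> where c: "(U, \<phi>) \<in> charts_at M p"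
    using charted_space.obtain_some_chart[OF charted_space p] by metis
  have chart: "is_chart (topo M) (U, \<phi>)" and pU: "p \<in> U" and atl: "(U, \<phi>) \<in> atlas M"
    using charts charts_atD[OF c] by auto
  have inj: "inj_on \<phi> U" and U: "openin (topo M) U"
    using is_chart_inj[OF chart] chart by (auto simp: is_chart_def)
  define w where "w = v (U, \<phi>)"
  define line where "line = (\<lambda>t::real. \<phi> p + t *\<^sub>R w)"
  define \<gamma> where "\<gamma> t = inv_into U \<phi> (line t)" for t
  have cont: "continuous_on UNIV line"
    unfolding line_def by (intro continuous_intros)
  have pre: "open (line -` \<phi> ` (U \<inter> S))" if "openin (topo M) S" for S
    using is_chart_image_open[OF chart that] cont by (simp add: open_vimage)
  have "0 \<in> line -` \<phi> ` (U \<inter> topspace (topo M))"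
    using pU p by (auto simp: line_def)
  then obtain \<epsilon> where e: "\<epsilon> > 0" "ball 0 \<epsilon> \<subseteq> line -` \<phi> ` (U \<inter> topspace (topo M))"
    using pre[OF openin_topspace] open_contains_ball by blast
  define I where "I = {-\<epsilon><..<\<epsilon>}"
  have I: "line t \<in> \<phi> ` U" if "t \<in> I" for t
  proof -
    have "t \<in> ball 0 \<epsilon>"
      using that by (auto simp: I_def dist_real_def)
    then show ?thesis
      using e(2) by blast
  qed
  have mem: "\<gamma> t \<in> S \<longleftrightarrow> line t \<in> \<phi> ` (U \<inter> S)" if "t \<in> I" for t S
    using I[OF that] inj by (auto simp: \<gamma>_def inv_into_f_f inj_on_eq_iff)
  have \<gamma>0: "\<gamma> 0 = p"
    using inj pU by (simp add: \<gamma>_def line_def)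
  have open_I: "open {t \<in> I. \<gamma> t \<in> S}" if "openin (topo M) S" for S
  proof -
    have "{t \<in> I. \<gamma> t \<in> S} = I \<inter> line -` \<phi> ` (U \<inter> S)"
      using mem by auto
    then show ?thesis
      using pre[OF that] by (simp add: I_def open_Int)
  qed
  have "continuous_map (top_of_set I) (topo M) \<gamma>"
    unfolding continuous_map_def
  proof (intro conjI allI impI)
    show "\<gamma> \<in> topspace (top_of_set I) \<rightarrow> topspace (topo M)"
      using inv_into_into[OF I] openin_subset[OF U] by (fastforce simp: \<gamma>_def)
    show "openin (top_of_set I) {x \<in> topspace (top_of_set I). \<gamma> x \<in> S}" if "openin (topo M) S" for S
      using open_I[OF that] by (auto simp: I_def intro: open_openin_trans open_subset)
  qed
  \<comment> \<open>in another chart the curve is a transition map along a line\<close>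
  moreover have "smooth_on (\<lambda>t. \<psi> (\<gamma> (inv_into I id t))) (id ` (I \<inter> \<gamma> -` V))"
    if d: "(V, \<psi>) \<in> atlas M" for V \<psi>
    unfolding smooth_on_def
  proof
    fix k
    have V: "openin (topo M) V"
      using charts[OF d] by (simp add: is_chart_def)
    have "Ck_on k (\<lambda>x. \<psi> (inv_into U \<phi> x)) (\<phi> ` (U \<inter> V))"
      using transitions[OF atl d] by (simp add: smooth_transition_def smooth_on_def)
    from Ck_on_affine_line[OF this is_chart_image_open[OF chart V], of "\<phi> p" w]
    have "Ck_on k (\<lambda>t. \<psi> (\<gamma> t)) {t. line t \<in> \<phi> ` (U \<inter> V)}"
      by (simp add: \<gamma>_def line_def)
    then have "Ck_on k (\<lambda>t. \<psi> (\<gamma> t)) {t \<in> I. \<gamma> t \<in> V}"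
      by (rule Ck_on_subset) (use mem in auto)
    then have "Ck_on k (\<lambda>t. \<psi> (\<gamma> (inv_into I id t))) {t \<in> I. \<gamma> t \<in> V}"
      by (rule Ck_on_cong[OF _ open_I[OF V]]) (simp add: inv_into_id)
    moreover have "id ` (I \<inter> \<gamma> -` V) = {t \<in> I. \<gamma> t \<in> V}"
      by auto
    ultimately show "Ck_on k (\<lambda>t. \<psi> (\<gamma> (inv_into I id t))) (id ` (I \<inter> \<gamma> -` V))"
      by simp
  qed
  ultimately have "smooth_map (open_manifold I) M \<gamma>"
    by (auto simp: smooth_map_def open_manifold_def)
  then have smooth: "smooth_curve M \<gamma>"
    using e(1) by (auto simp: smooth_curve_def I_def)
  have "velocity M \<gamma> d = v d" for d
  proof -
    obtain V \<psi> where [simp]: "d = (V, \<psi>)" by (cases d)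
    show ?thesis
    proof (cases "(V, \<psi>) \<in> charts_at M p")
      case True
      let ?f = "\<lambda>x. \<psi> (inv_into U \<phi> x)"
      have f: "(?f has_derivative frechet_derivative ?f (at (line 0))) (at (line 0))"
        using iffD1[OF frechet_derivative_works transition_differentiable[OF c True]]
        by (simp add: line_def)
      have "(line has_vector_derivative w) (at 0)"
        unfolding line_def by (auto intro!: derivative_eq_intros)
      from vector_derivative_diff_chain_within[OF this has_derivative_at_withinI[OF f]]
      have "vector_derivative (\<lambda>t. \<psi> (\<gamma> t)) (at 0) = frechet_derivative ?f (at (\<phi> p)) w"
        by (intro vector_derivative_at) (simp add: o_def \<gamma>_def line_def)
      with True show ?thesis
        by (simp add: velocity_def \<gamma>0 w_def tangent_space_transition[OF v c])
    qed (simp add: velocity_def \<gamma>0 tangent_space_outside[OF v])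
  qed
  then show ?thesis
    using that[OF smooth \<gamma>0] by blast
qed

section \<open>Linear forms that vanish on a common kernel\<close>

text \<open>Linearity is asked for on \<open>V\<close> only, since forms on the Lie algebra are extended by 0
  outside it and are in general not linear on the ambient function space.\<close>

definition linear_form_on :: "'v::real_vector set \<Rightarrow> ('v \<Rightarrow> real) \<Rightarrow> bool" where
  "linear_form_on V \<alpha> \<longleftrightarrow> (\<forall>x\<in>V. \<forall>y\<in>V. \<forall>r. \<alpha> (x + r *\<^sub>R y) = \<alpha> x + r * \<alpha> y)"

text \<open>Induction on the number of forms. On the common kernel of the \<open>a j\<close> with \<open>j\<close> in
  \<open>J\<close>, the form \<open>\<alpha>\<close> vanishes wherever the new form \<open>a i\<close> does, so there \<open>\<alpha>\<close> is a
  multiple of \<open>a i\<close>; the induction hypothesis applies to \<open>\<alpha>\<close> minus this multiple.\<close>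

lemma vanishing_on_common_kernel:
  fixes \<alpha> :: "'v::real_vector \<Rightarrow> real" and a :: "'i \<Rightarrow> 'v \<Rightarrow> real"
  assumes "finite J" and V: "subspace V" and "\<And>j. j \<in> J \<Longrightarrow> linear_form_on V (a j)"
    and "linear_form_on V \<alpha>" and "\<And>x. x \<in> V \<Longrightarrow> (\<forall>j\<in>J. a j x = 0) \<Longrightarrow> \<alpha> x = 0"
  shows "\<exists>\<mu>. \<forall>x\<in>V. \<alpha> x = (\<Sum>j\<in>J. \<mu> j * a j x)"
  using assms(1,3-)
proof (induction J arbitrary: \<alpha> rule: finite_induct)
  case empty
  then show ?case by simp
next
  case (insert i J)
  have lin: "a j (x + r *\<^sub>R y) = a j x + r * a j y" if "j \<in> insert i J" "x \<in> V" "y \<in> V" for j x y r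
    using insert.prems(1)[OF that(1)] that(2,3) by (simp add: linear_form_on_def)
  have lin\<alpha>: "\<alpha> (x + r *\<^sub>R y) = \<alpha> x + r * \<alpha> y" if "x \<in> V" "y \<in> V" for x y r
    using insert.prems(2) that by (simp add: linear_form_on_def)
  obtain \<kappa> where \<kappa>: "\<alpha> x = \<kappa> * a i x" if "x \<in> V" "\<forall>j\<in>J. a j x = 0" for x
  \<comment> \<open>the multiple is read off at a vector where the new form is non-zero, if there is one\<close>
  proof (cases "\<exists>y\<in>V. (\<forall>j\<in>J. a j y = 0) \<and> a i y \<noteq> 0")
    case False
    show ?thesis
    proof (rule that[of 0])
      show "\<alpha> x = 0 * a i x" if "x \<in> V" "\<forall>j\<in>J. a j x = 0" for x
        using False that insert.prems(3)[of x] by auto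
    qed
  next
    case True
    then obtain y where y: "y \<in> V" "\<forall>j\<in>J. a j y = 0" "a i y \<noteq> 0"
      by blast
    show ?thesis
    proof (rule that[of "\<alpha> y / a i y"])
      fix x assume x: "x \<in> V" "\<forall>j\<in>J. a j x = 0"
      define r where "r = - (a i x / a i y)"
      have "x + r *\<^sub>R y \<in> V"
        using V x(1) y(1) by (intro subspace_add subspace_scale)
      moreover have "\<forall>j\<in>insert i J. a j (x + r *\<^sub>R y) = 0"
        using lin[OF _ x(1) y(1), of _ r] x(2) y(2,3) by (simp add: r_def)
      ultimately have "\<alpha> (x + r *\<^sub>R y) = 0"
        by (rule insert.prems(3))
      then have "\<alpha> x + r * \<alpha> y = 0"
        by (simp only: lin\<alpha>[OF x(1) y(1)])
      then show "\<alpha> x = \<alpha> y / a i y * a i x"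
        using y(3) by (simp add: r_def field_simps)
    qed
  qed
  have "linear_form_on V (\<lambda>x. \<alpha> x - \<kappa> * a i x)"
    by (simp add: linear_form_on_def lin lin\<alpha> algebra_simps)
  moreover have "\<alpha> x - \<kappa> * a i x = 0" if "x \<in> V" "\<forall>j\<in>J. a j x = 0" for x
    using \<kappa>[OF that] by simp
  ultimately obtain \<mu> where \<mu>: "\<And>x. x \<in> V \<Longrightarrow> \<alpha> x - \<kappa> * a i x = (\<Sum>j\<in>J. \<mu> j * a j x)"
    using insert.IH[of "\<lambda>x. \<alpha> x - \<kappa> * a i x"] insert.prems(1) by blast
  have "\<alpha> x = (\<Sum>j\<in>insert i J. (\<mu>(i := \<kappa>)) j * a j x)" if "x \<in> V" for x
  proof -
    have "(\<Sum>j\<in>J. (\<mu>(i := \<kappa>)) j * a j x) = (\<Sum>j\<in>J. \<mu> j * a j x)"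
      using insert.hyps(2) by (intro sum.cong) auto
    then show ?thesis
      using \<mu>[OF that] insert.hyps by simp
  qed
  then show ?case by blast
qed

section \<open>Velocities in a Lie group\<close>

lemma tangent_map_real_line_cong:
  assumes "\<forall>\<^sub>F t in nhds 0. c t = d t"
  shows "tangent_map real_line M c 0 = tangent_map real_line M d 0"
proof -
  obtain S where S: "open S" "0 \<in> S" "\<And>t. t \<in> S \<Longrightarrow> c t = d t"
    using assms unfolding eventually_nhds by blast
  show ?thesis
    by (rule tangent_map_cong[OF charted_space_real_line, of _ S]) (use S in \<open>auto simp: open_manifold_def\<close>)
qed

text \<open>The reduced variation of one increment, as a function of the two neighbouring points and
  their variations; it is the velocity of $p^{-1}q$ when $p$ and $q$ move with velocities $u$
  and $v$.\<close>

definition increment_variation ::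
    "'a monoid \<Rightarrow> ('a, 'e::real_normed_vector) manifold \<Rightarrow> 'a \<Rightarrow> 'a \<Rightarrow>
     ('a, 'e) tangent_vector \<Rightarrow> ('a, 'e) tangent_vector \<Rightarrow> ('a, 'e) tangent_vector" where
  "increment_variation G M p q u v =
     from_lie_algebra G M (inv\<^bsub>G\<^esub> p \<otimes>\<^bsub>G\<^esub> q)
       (to_lie_algebra G M q v - Ad G M (inv\<^bsub>G\<^esub> (inv\<^bsub>G\<^esub> p \<otimes>\<^bsub>G\<^esub> q)) (to_lie_algebra G M p u))"

lemma reduced_variation_eq:
  "reduced_variation G M g \<delta> k = increment_variation G M (g k) (g (k + 1)) (\<delta> k) (\<delta> (k + 1))"
  by (simp add: reduced_variation_def increment_variation_def increments_def)

context lie_group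
begin

lemma multiplication_differentiable:
  "p \<in> carrier G \<Longrightarrow> q \<in> carrier G \<Longrightarrow>
     differentiable_map (prod_manifold M M) M (\<lambda>(x, y). x \<otimes> y) (p, q)"
  by (intro smooth_map_differentiable charted_space_prod_manifold charted_space smooth_mult)
    (simp add: prod_manifold_def carrier)

lemma differentiable_map_mult:
  assumes Q: "charted_space Q" and A: "differentiable_map Q M A r" and B: "differentiable_map Q M B r"
  shows "differentiable_map Q M (\<lambda>z. A z \<otimes> B z) r"
  using differentiable_map_compose[OF Q charted_space_prod_manifold[OF charted_space charted_space]
      differentiable_map_Pair[OF Q A B] multiplication_differentiable]
    differentiable_map_topspace(2)[OF Q A] differentiable_map_topspace(2)[OF Q B]
  by (simp add: carrier)

lemma differentiable_map_inv:
  assumes Q: "charted_space Q" and A: "differentiable_map Q M A r"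
  shows "differentiable_map Q M (\<lambda>z. inv (A z)) r"
  using differentiable_map_topspace(2)[OF Q A]
  by (intro differentiable_map_compose[OF Q charted_space A]
      smooth_map_differentiable[OF charted_space smooth_inv])

lemma tangent_map_mult:
  assumes Q: "charted_space Q" and A: "differentiable_map Q M A r" and B: "differentiable_map Q M B r"
  shows "tangent_map Q M (\<lambda>z. A z \<otimes> B z) r v =
     tangent_map M M (\<lambda>x. x \<otimes> B r) (A r) (tangent_map Q M A r v) +
     TL G M (A r) (B r) (tangent_map Q M B r v)"
  using tangent_map_product_rule[OF smooth_manifold_axioms smooth_manifold_axioms Q A B
      multiplication_differentiable]
    differentiable_map_topspace(2)[OF Q A] differentiable_map_topspace(2)[OF Q B]
  by (simp add: TL_def carrier)

lemma differentiable_map_left: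
  "h \<in> carrier G \<Longrightarrow> p \<in> carrier G \<Longrightarrow> differentiable_map M M (\<lambda>x. h \<otimes> x) p"
  by (intro differentiable_map_mult charted_space differentiable_map_const differentiable_map_id)
    (simp_all add: carrier)

lemma differentiable_map_right:
  "h \<in> carrier G \<Longrightarrow> p \<in> carrier G \<Longrightarrow> differentiable_map M M (\<lambda>x. x \<otimes> h) p"
  by (intro differentiable_map_mult charted_space differentiable_map_const differentiable_map_id)
    (simp_all add: carrier)

lemma tangent_map_cong_carrier:
  assumes "p \<in> carrier G" "\<And>x. x \<in> carrier G \<Longrightarrow> F x = H x"
  shows "tangent_map M N F p = tangent_map M N H p"
  using assms by (intro tangent_map_cong[OF charted_space, of _ "carrier G"])
    (simp_all flip: carrier)

lemma linear_TL: "h \<in> carrier G \<Longrightarrow> p \<in> carrier G \<Longrightarrow> linear (TL G M h p)"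
  unfolding TL_def by (intro linear_tangent_map charted_space differentiable_map_left)

lemma TL_in_tangent_space:
  "h \<in> carrier G \<Longrightarrow> p \<in> carrier G \<Longrightarrow> TL G M h p v \<in> tangent_space M (h \<otimes> p)"
  unfolding TL_def by (intro tangent_map_in_tangent_space charted_space differentiable_map_left)

lemma TL_TL:
  assumes "h \<in> carrier G" "k \<in> carrier G" "p \<in> carrier G"
  shows "TL G M h (k \<otimes> p) (TL G M k p v) = TL G M (h \<otimes> k) p v"
proof -
  have "TL G M h (k \<otimes> p) (TL G M k p v) = tangent_map M M (\<lambda>x. h \<otimes> (k \<otimes> x)) p v"
    unfolding TL_def using assms
    by (intro tangent_map_compose[symmetric] charted_space differentiable_map_left) simp_all
  also have "\<dots> = TL G M (h \<otimes> k) p v"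
    unfolding TL_def using assms by (subst tangent_map_cong_carrier) (simp_all add: m_assoc)
  finally show ?thesis .
qed

lemma TL_one:
  assumes "p \<in> carrier G" "v \<in> tangent_space M p"
  shows "TL G M \<one> p v = v"
proof -
  have "TL G M \<one> p v = tangent_map M M (\<lambda>x. x) p v"
    unfolding TL_def using assms by (subst tangent_map_cong_carrier) simp_all
  then show ?thesis
    using assms tangent_map_id carrier by simp
qed

lemma to_lie_algebra_in: "p \<in> carrier G \<Longrightarrow> to_lie_algebra G M p v \<in> lie_algebra G M"
  using TL_in_tangent_space[of "inv p" p v] by (simp add: to_lie_algebra_def lie_algebra_def)

lemma from_lie_algebra_in: "p \<in> carrier G \<Longrightarrow> from_lie_algebra G M p \<xi> \<in> tangent_space M p"
  using TL_in_tangent_space[of p \<one> \<xi>] by (simp add: from_lie_algebra_def)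

lemma from_to_lie_algebra:
  "p \<in> carrier G \<Longrightarrow> v \<in> tangent_space M p \<Longrightarrow>
     from_lie_algebra G M p (to_lie_algebra G M p v) = v"
  using TL_TL[of p "inv p" p v] by (simp add: from_lie_algebra_def to_lie_algebra_def TL_one)

lemma to_from_lie_algebra:
  "p \<in> carrier G \<Longrightarrow> \<xi> \<in> lie_algebra G M \<Longrightarrow>
     to_lie_algebra G M p (from_lie_algebra G M p \<xi>) = \<xi>"
  using TL_TL[of "inv p" p \<one> \<xi>]
  by (simp add: from_lie_algebra_def to_lie_algebra_def TL_one lie_algebra_def)

lemma linear_to_lie_algebra: "p \<in> carrier G \<Longrightarrow> linear (to_lie_algebra G M p)"
  unfolding to_lie_algebra_def[abs_def] by (intro linear_TL) simp_all

lemma linear_from_lie_algebra: "p \<in> carrier G \<Longrightarrow> linear (from_lie_algebra G M p)"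
  unfolding from_lie_algebra_def[abs_def] by (intro linear_TL) simp_all

lemma differentiable_map_conjugation:
  "h \<in> carrier G \<Longrightarrow> differentiable_map M M (\<lambda>x. h \<otimes> x \<otimes> inv h) \<one>"
  by (intro differentiable_map_mult charted_space differentiable_map_const differentiable_map_id)
    (simp_all add: carrier)

lemma linear_Ad: "h \<in> carrier G \<Longrightarrow> linear (Ad G M h)"
  unfolding Ad_def by (intro linear_tangent_map charted_space differentiable_map_conjugation)

text \<open>With $w = c^{-1}d$ and $W = w(0)$, the product rule for $d = c\,w$ reads
  $d' = c'W + p\,w'$. Left translation by $q^{-1} = W^{-1}p^{-1}$ turns the first summand into
  $\mathrm{Ad}_{W^{-1}}(p^{-1}c')$ and the second into $W^{-1}w'$, and the equation can be solved for
  $w'$.\<close>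

lemma velocity_increment:
  assumes c: "differentiable_map real_line M c 0" and d: "differentiable_map real_line M d 0"
  shows "velocity M (\<lambda>t. inv (c t) \<otimes> d t) =
    increment_variation G M (c 0) (d 0) (velocity M c) (velocity M d)"
proof -
  note R = charted_space_real_line
  define p q w where "p = c 0" and "q = d 0" and "w = (\<lambda>t. inv (c t) \<otimes> d t)"
  define W where "W = inv p \<otimes> q"
  have pq [simp]: "p \<in> carrier G" "q \<in> carrier G"
    using differentiable_map_topspace(2)[OF R c] differentiable_map_topspace(2)[OF R d]
    by (auto simp: p_def q_def carrier)
  have W [simp]: "W \<in> carrier G" and w0: "w 0 = W"
    by (simp_all add: W_def) (simp add: w_def p_def q_def)
  have pW [simp]: "p \<otimes> W = q"
    unfolding W_def by (subst m_assoc[symmetric]) simp_all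
  have qp: "inv q \<otimes> p = inv W"
    unfolding W_def by (subst inv_mult_group) simp_all
  have Wp: "inv W \<otimes> inv p = inv q"
    using inv_mult_group[of p W] by simp
  have w: "differentiable_map real_line M w 0"
    unfolding w_def by (intro differentiable_map_mult differentiable_map_inv R c d)
  have "\<forall>\<^sub>F t in nhds 0. c t \<in> carrier G" "\<forall>\<^sub>F t in nhds 0. d t \<in> carrier G"
    using c d unfolding differentiable_curve_iff by (auto simp: limitin_def simp flip: carrier)
  then have "\<forall>\<^sub>F t in nhds 0. d t = c t \<otimes> w t"
  proof eventually_elim
    case (elim t)
    then have "c t \<otimes> w t = (c t \<otimes> inv (c t)) \<otimes> d t"
      unfolding w_def by (intro m_assoc[symmetric]) simp_all
    with elim show ?case by simp
  qed
  then have "velocity M d = tangent_map real_line M (\<lambda>t. c t \<otimes> w t) 0 (\<lambda>_. 1)"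
    by (simp only: velocity_eq_tangent_map[OF d] tangent_map_real_line_cong)
  also have "\<dots> = tangent_map M M (\<lambda>x. x \<otimes> W) p (velocity M c) + TL G M p W (velocity M w)"
    by (simp add: tangent_map_mult[OF R c w] velocity_eq_tangent_map[OF c]
        velocity_eq_tangent_map[OF w] w0 flip: p_def)
  finally have d': "velocity M d =
      tangent_map M M (\<lambda>x. x \<otimes> W) p (velocity M c) + TL G M p W (velocity M w)" .
  have right: "to_lie_algebra G M q (tangent_map M M (\<lambda>x. x \<otimes> W) p (velocity M c)) =
      Ad G M (inv W) (to_lie_algebra G M p (velocity M c))"
  proof -
    have "to_lie_algebra G M q (tangent_map M M (\<lambda>x. x \<otimes> W) p (velocity M c)) =
        tangent_map M M (\<lambda>x. inv q \<otimes> (x \<otimes> W)) p (velocity M c)"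
      using tangent_map_compose[OF charted_space charted_space differentiable_map_right[of W p]
        differentiable_map_left[of "inv q" "p \<otimes> W"]]
      by (simp add: to_lie_algebra_def TL_def)
    also have "\<dots> = tangent_map M M (\<lambda>x. inv W \<otimes> (inv p \<otimes> x) \<otimes> inv (inv W)) p (velocity M c)"
      by (subst tangent_map_cong_carrier) (simp_all add: Wp flip: m_assoc)
    also have "\<dots> = Ad G M (inv W) (to_lie_algebra G M p (velocity M c))"
      using tangent_map_compose[OF charted_space charted_space differentiable_map_left[of "inv p" p],
          of M "\<lambda>x. inv W \<otimes> x \<otimes> inv (inv W)"] differentiable_map_conjugation[of "inv W"]
      by (simp add: to_lie_algebra_def TL_def Ad_def)
    finally show ?thesis .
  qed
  have left: "to_lie_algebra G M q (TL G M p W (velocity M w)) = TL G M (inv W) W (velocity M w)"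
    using TL_TL[of "inv q" p W "velocity M w"] by (simp add: to_lie_algebra_def qp)
  have "to_lie_algebra G M q (velocity M d) - Ad G M (inv W) (to_lie_algebra G M p (velocity M c)) =
      TL G M (inv W) W (velocity M w)"
    by (simp add: d' linear_add[OF linear_to_lie_algebra] right left)
  moreover have "velocity M w \<in> tangent_space M W"
    using tangent_map_in_tangent_space[OF R w] by (simp add: velocity_eq_tangent_map[OF w] w0)
  ultimately have "increment_variation G M p q (velocity M c) (velocity M d) = velocity M w"
    using from_to_lie_algebra[of W "velocity M w"]
    by (simp add: increment_variation_def to_lie_algebra_def flip: W_def)
  then show ?thesis
    by (simp add: p_def q_def w_def)
qed

end

section \<open>First variations and their reduction\<close>

locale reduced_lagrangian = lie_group G M
  for G :: "'a monoid" (structure) and M :: "('a, 'e::real_normed_vector) manifold" +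
  fixes L :: "'a \<times> 'a \<Rightarrow> real" and l :: "'a \<Rightarrow> real"
  assumes L_smooth: "smooth_function (prod_manifold M M) L"
    and l_reduced: "\<And>x y. x \<in> carrier G \<Longrightarrow> y \<in> carrier G \<Longrightarrow> L (x, y) = l (inv x \<otimes> y)"
begin

lemma L_differentiable:
  assumes "p \<in> carrier G" "q \<in> carrier G"
  shows "differentiable_map (prod_manifold M M) real_line L (p, q)"
  using assms L_smooth
  by (intro smooth_map_differentiable charted_space_prod_manifold charted_space)
    (simp_all add: smooth_function_def prod_manifold_def carrier)

lemma L_partially_differentiable:
  assumes "p \<in> carrier G" "q \<in> carrier G"
  shows "differentiable_map M real_line (\<lambda>x. L (x, q)) p"
    and "differentiable_map M real_line (\<lambda>y. L (p, y)) q"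
proof -
  note MM = charted_space_prod_manifold[OF charted_space charted_space]
  have p: "p \<in> topspace (topo M)" and q: "q \<in> topspace (topo M)"
    using assms by (simp_all add: carrier)
  note pair = differentiable_map_Pair[OF charted_space]
  show "differentiable_map M real_line (\<lambda>x. L (x, q)) p"
    by (rule differentiable_map_compose[OF charted_space MM
          pair[OF differentiable_map_id[OF p] differentiable_map_const[OF p q]]
          L_differentiable[OF assms]])
  show "differentiable_map M real_line (\<lambda>y. L (p, y)) q"
    by (rule differentiable_map_compose[OF charted_space MM
          pair[OF differentiable_map_const[OF q p] differentiable_map_id[OF q]]
          L_differentiable[OF assms]])
qed

text \<open>On the group, \<open>l\<close> is the restriction of \<open>L\<close> to a slice: $l(x) = L(e, x)$.\<close>

lemma l_differentiable:
  assumes p: "p \<in> carrier G"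
  shows "differentiable_map M real_line l p"
proof (rule differentiable_map_cong[OF charted_space])
  show "differentiable_map M real_line (\<lambda>x. L (\<one>, x)) p"
    by (rule L_partially_differentiable(2)[OF one_closed p])
  show "openin (topo M) (carrier G)" "p \<in> carrier G"
    using p by (simp_all flip: carrier)
  show "L (\<one>, x) = l x" if "x \<in> carrier G" for x
    using l_reduced[OF one_closed that] that by simp
qed

lemma linear_differential:
  assumes "charted_space N" "differentiable_map N real_line F p"
  shows "linear (differential N F p)"
proof -
  note lin = linear_tangent_map[OF assms]
  show ?thesis
    by (rule linearI)
      (simp_all add: linear_add[OF lin] linear_scale[OF lin] scaleR_fun_apply
        flip: tangent_map_real_line)
qed

lemma has_real_derivative_L:
  assumes c: "smooth_curve M c" and d: "smooth_curve M d"
    and pq: "c 0 \<in> carrier G" "d 0 \<in> carrier G"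
  shows "((\<lambda>t. L (c t, d t)) has_real_derivative
     D1 M L (c 0, d 0) (velocity M c) + D2 M L (c 0, d 0) (velocity M d)) (at 0)"
  using has_real_derivative_along_curves[OF smooth_manifold_axioms smooth_manifold_axioms
      smooth_curve_differentiable[OF charted_space c] smooth_curve_differentiable[OF charted_space d]
      L_differentiable[OF pq]]
  by (simp add: D1_def D2_def)

text \<open>Both sides are the derivative of $L(c(t),d(t)) = l(c(t)^{-1}d(t))$ at 0, for curves \<open>c\<close> and
  \<open>d\<close> with velocities \<open>u\<close> and \<open>v\<close>.\<close>

lemma D1_D2_eq_reduced:
  assumes p: "p \<in> carrier G" and q: "q \<in> carrier G"
    and u: "u \<in> tangent_space M p" and v: "v \<in> tangent_space M q"
  shows "D1 M L (p, q) u + D2 M L (p, q) v =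
     differential M l (inv p \<otimes> q) (increment_variation G M p q u v)"
proof -
  obtain c where c: "smooth_curve M c" "c 0 = p" "velocity M c = u"
    using tangent_vector_curve p u carrier by metis
  obtain d where d: "smooth_curve M d" "d 0 = q" "velocity M d = v"
    using tangent_vector_curve q v carrier by metis
  note c' = smooth_curve_differentiable[OF charted_space c(1)]
  note d' = smooth_curve_differentiable[OF charted_space d(1)]
  have "\<forall>\<^sub>F t in nhds 0. c t \<in> carrier G" "\<forall>\<^sub>F t in nhds 0. d t \<in> carrier G"
    using c' d' unfolding differentiable_curve_iff by (auto simp: limitin_def simp flip: carrier)
  then have eq: "\<forall>\<^sub>F t in nhds 0. L (c t, d t) = l (inv (c t) \<otimes> d t)"
    by eventually_elim (rule l_reduced)
  have "((\<lambda>t. l (inv (c t) \<otimes> d t)) has_real_derivative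
      differential M l (inv p \<otimes> q) (increment_variation G M p q u v)) (at 0)"
    using has_real_derivative_along_curve[OF charted_space, of "\<lambda>t. inv (c t) \<otimes> d t" l]
      differentiable_map_mult[OF charted_space_real_line
        differentiable_map_inv[OF charted_space_real_line c'] d']
      l_differentiable[of "inv p \<otimes> q"] p q
    by (simp add: velocity_increment[OF c' d'] c d)
  moreover have "((\<lambda>t. L (c t, d t)) has_real_derivative
      D1 M L (p, q) u + D2 M L (p, q) v) (at 0)"
    using has_real_derivative_L[OF c(1) d(1)] p q by (simp add: c d)
  ultimately show ?thesis
    using DERIV_cong_ev[OF refl eq refl] DERIV_unique by blast
qed

text \<open>The left-hand side of the reduced equation of motion at an inner site with incoming increment
  \<open>V\<close> and outgoing increment \<open>W\<close>.\<close>

definition momentum_balance :: "'a \<Rightarrow> 'a \<Rightarrow> ('a, 'e) tangent_vector \<Rightarrow> real" where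
  "momentum_balance V W \<xi> =
     differential M l V (from_lie_algebra G M V \<xi>) -
     differential M l W (from_lie_algebra G M W (Ad G M (inv W) \<xi>))"

lemma linear_reduced_force:
  assumes "W \<in> carrier G"
  shows "linear (\<lambda>\<xi>. differential M l W (from_lie_algebra G M W \<xi>))"
  using linear_compose[OF linear_from_lie_algebra linear_differential[OF charted_space l_differentiable]]
    assms by (auto simp: o_def)

lemma linear_momentum_balance:
  assumes "V \<in> carrier G" "W \<in> carrier G"
  shows "linear (momentum_balance V W)"
  unfolding momentum_balance_def[abs_def]
  using linear_compose[OF linear_Ad linear_reduced_force, of "inv W" W] assms
  by (intro linear_compose_sub linear_reduced_force) (auto simp: o_def)

lemma D1_zero: "p \<in> carrier G \<Longrightarrow> q \<in> carrier G \<Longrightarrow> D1 M L (p, q) 0 = 0"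
  using linear_0[OF linear_differential[OF charted_space L_partially_differentiable(1)]]
  by (simp add: D1_def)

lemma D2_zero: "p \<in> carrier G \<Longrightarrow> q \<in> carrier G \<Longrightarrow> D2 M L (p, q) 0 = 0"
  using linear_0[OF linear_differential[OF charted_space L_partially_differentiable(2)]]
  by (simp add: D2_def)

text \<open>Each partial derivative is \<open>D1_D2_eq_reduced\<close> with the other variation set to 0.\<close>

lemma euler_lagrange_eq_momentum_balance:
  assumes [simp]: "o' \<in> carrier G" "p \<in> carrier G" "q \<in> carrier G" and v: "v \<in> tangent_space M p"
  shows "D1 M L (p, q) v + D2 M L (o', p) v =
    momentum_balance (inv o' \<otimes> p) (inv p \<otimes> q) (to_lie_algebra G M p v)"
proof -
  have "D1 M L (p, q) v = - differential M l (inv p \<otimes> q) (from_lie_algebra G M (inv p \<otimes> q)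
      (Ad G M (inv (inv p \<otimes> q)) (to_lie_algebra G M p v)))"
    using D1_D2_eq_reduced[of p q v 0] v subspace_0[OF subspace_tangent_space, of q]
    by (simp add: D2_zero increment_variation_def linear_0[OF linear_to_lie_algebra]
        linear_neg[OF linear_reduced_force])
  moreover have "D2 M L (o', p) v =
      differential M l (inv o' \<otimes> p) (from_lie_algebra G M (inv o' \<otimes> p) (to_lie_algebra G M p v))"
    using D1_D2_eq_reduced[of o' p 0 v] v subspace_0[OF subspace_tangent_space, of o']
    by (simp add: D1_zero increment_variation_def linear_0[OF linear_to_lie_algebra]
        linear_0[OF linear_Ad])
  ultimately show ?thesis
    by (simp add: momentum_balance_def)
qed

definition first_variation :: "nat \<Rightarrow> (nat \<Rightarrow> 'a) \<Rightarrow> (nat \<Rightarrow> ('a, 'e) tangent_vector) \<Rightarrow> real" where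
  "first_variation N g \<delta> =
     (\<Sum>k<N. D1 M L (g k, g (k + 1)) (\<delta> k) + D2 M L (g k, g (k + 1)) (\<delta> (k + 1)))"

lemma first_variation_eq_reduced:
  assumes g: "\<And>k. k \<le> N \<Longrightarrow> g k \<in> carrier G"
    and \<delta>: "\<And>k. k \<le> N \<Longrightarrow> \<delta> k \<in> tangent_space M (g k)"
  shows "first_variation N g \<delta> =
    (\<Sum>k<N. differential M l (increments G g k) (reduced_variation G M g \<delta> k))"
  unfolding first_variation_def reduced_variation_eq increments_def
  by (intro sum.cong refl D1_D2_eq_reduced g \<delta>) auto

text \<open>Summation by parts: each inner site collects the contributions of its two neighbouring
  edges, and the end points contribute nothing.\<close>

lemma first_variation_eq_momentum_balance:
  assumes g: "\<And>k. k \<le> N \<Longrightarrow> g k \<in> carrier G"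
    and \<delta>: "\<And>k. k \<le> N \<Longrightarrow> \<delta> k \<in> tangent_space M (g k)" "\<delta> 0 = 0" "\<delta> N = 0"
  shows "first_variation N g \<delta> =
    (\<Sum>k\<in>{1..<N}. momentum_balance (increments G g (k - 1)) (increments G g k)
       (to_lie_algebra G M (g k) (\<delta> k)))"
proof (cases N)
  case 0
  then show ?thesis by (simp add: first_variation_def)
next
  case (Suc n)
  have "first_variation N g \<delta> = (\<Sum>k\<le>n. D1 M L (g k, g (k + 1)) (\<delta> k)) +
      (\<Sum>k\<le>n. D2 M L (g k, g (k + 1)) (\<delta> (k + 1)))"
    by (simp add: first_variation_def Suc sum.distrib lessThan_Suc_atMost)
  also have "(\<Sum>k\<le>n. D1 M L (g k, g (k + 1)) (\<delta> k)) =
      (\<Sum>k<n. D1 M L (g (Suc k), g (Suc k + 1)) (\<delta> (Suc k)))"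
    using g[of 0] g[of 1] \<delta>(2) Suc by (simp add: sum.atMost_shift D1_zero)
  also have "(\<Sum>k\<le>n. D2 M L (g k, g (k + 1)) (\<delta> (k + 1))) =
      (\<Sum>k<n. D2 M L (g k, g (Suc k)) (\<delta> (Suc k)))"
    using g[of n] g[of "Suc n"] \<delta>(3) Suc by (simp add: D2_zero flip: lessThan_Suc_atMost)
  also have "(\<Sum>k<n. D1 M L (g (Suc k), g (Suc k + 1)) (\<delta> (Suc k))) +
      (\<Sum>k<n. D2 M L (g k, g (Suc k)) (\<delta> (Suc k))) =
      (\<Sum>k<n. momentum_balance (increments G g k) (increments G g (Suc k))
         (to_lie_algebra G M (g (Suc k)) (\<delta> (Suc k))))"
    unfolding sum.distrib[symmetric] increments_def Suc_eq_plus1[symmetric]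
    by (intro sum.cong refl euler_lagrange_eq_momentum_balance g \<delta>(1)) (auto simp: Suc)
  also have "\<dots> = (\<Sum>k\<in>{1..<N}. momentum_balance (increments G g (k - 1)) (increments G g k)
       (to_lie_algebra G M (g k) (\<delta> k)))"
    using sum.shift_bounds_Suc_ivl[of "\<lambda>k. momentum_balance (increments G g (k - 1)) (increments G g k)
       (to_lie_algebra G M (g k) (\<delta> k))" 0 n]
    by (simp add: Suc lessThan_atLeast0)
  finally show ?thesis .
qed

lemma realizing_curves_exist:
  assumes "\<And>k. k < n \<Longrightarrow> x k \<in> carrier G" "\<And>k. k < n \<Longrightarrow> \<delta> k \<in> tangent_space M (x k)"
  obtains c where "realizes_variation M n x \<delta> c"
proof -
  have "\<exists>c. smooth_curve M c \<and> c 0 = x k \<and> velocity M c = \<delta> k" if "k < n" for k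
    using tangent_vector_curve[of "x k" "\<delta> k"] assms[OF that] carrier by metis
  then obtain c where "\<And>k. k < n \<Longrightarrow> smooth_curve M (c k) \<and> c k 0 = x k \<and> velocity M (c k) = \<delta> k"
    by metis
  then show ?thesis
    using that by (auto simp: realizes_variation_def)
qed

lemma critical_action_sum_iff:
  assumes g: "\<And>k. k \<le> N \<Longrightarrow> g k \<in> carrier G"
    and V: "\<And>\<delta> k. \<delta> \<in> V \<Longrightarrow> k \<le> N \<Longrightarrow> \<delta> k \<in> tangent_space M (g k)"
  shows "critical_point M (N + 1) (action_sum L N) g V \<longleftrightarrow> (\<forall>\<delta>\<in>V. first_variation N g \<delta> = 0)"
proof -
  have deriv: "((\<lambda>t. action_sum L N (\<lambda>k. c k t)) has_real_derivative first_variation N g \<delta>) (at 0)"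
    if c: "realizes_variation M (N + 1) g \<delta> c" for \<delta> c
    unfolding action_sum_def first_variation_def
  proof (rule DERIV_sum)
    fix k assume "k \<in> {..<N}"
    then have "smooth_curve M (c k)" "c k 0 = g k" "velocity M (c k) = \<delta> k"
      "smooth_curve M (c (k + 1))" "c (k + 1) 0 = g (k + 1)" "velocity M (c (k + 1)) = \<delta> (k + 1)"
      "g k \<in> carrier G" "g (k + 1) \<in> carrier G"
      using c g by (auto simp: realizes_variation_def)
    then show "((\<lambda>t. L (c k t, c (k + 1) t)) has_real_derivative
        D1 M L (g k, g (k + 1)) (\<delta> k) + D2 M L (g k, g (k + 1)) (\<delta> (k + 1))) (at 0)"
      using has_real_derivative_L[of "c k" "c (k + 1)"] by simp
  qed
  show ?thesis
  proof
    assume crit: "critical_point M (N + 1) (action_sum L N) g V"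
    show "\<forall>\<delta>\<in>V. first_variation N g \<delta> = 0"
    proof
      fix \<delta> assume \<delta>: "\<delta> \<in> V"
      obtain c where c: "realizes_variation M (N + 1) g \<delta> c"
        using realizing_curves_exist[of "N + 1" g \<delta>] g V[OF \<delta>] by auto
      with crit \<delta> have "((\<lambda>t. action_sum L N (\<lambda>k. c k t)) has_real_derivative 0) (at 0)"
        by (auto simp: critical_point_def)
      with deriv[OF c] show "first_variation N g \<delta> = 0"
        by (rule DERIV_unique)
    qed
  next
    assume "\<forall>\<delta>\<in>V. first_variation N g \<delta> = 0"
    then show "critical_point M (N + 1) (action_sum L N) g V"
      unfolding critical_point_def using deriv by metis
  qed
qed

lemma critical_reduced_action_sum_iff:
  assumes W: "\<And>k. k < N \<Longrightarrow> W k \<in> carrier G"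
    and V: "\<And>\<delta> k. \<delta> \<in> V \<Longrightarrow> k < N \<Longrightarrow> \<delta> k \<in> tangent_space M (W k)"
  shows "critical_point M N (reduced_action_sum l N) W V \<longleftrightarrow>
    (\<forall>\<delta>\<in>V. (\<Sum>k<N. differential M l (W k) (\<delta> k)) = 0)"
proof -
  have deriv: "((\<lambda>t. reduced_action_sum l N (\<lambda>k. c k t)) has_real_derivative
      (\<Sum>k<N. differential M l (W k) (\<delta> k))) (at 0)"
    if c: "realizes_variation M N W \<delta> c" for \<delta> c
    unfolding reduced_action_sum_def
  proof (rule DERIV_sum)
    fix k assume "k \<in> {..<N}"
    then have "smooth_curve M (c k)" "c k 0 = W k" "velocity M (c k) = \<delta> k" "W k \<in> carrier G"
      using c W by (auto simp: realizes_variation_def)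
    then show "((\<lambda>t. l (c k t)) has_real_derivative differential M l (W k) (\<delta> k)) (at 0)"
      using has_real_derivative_along_curve[OF charted_space
          smooth_curve_differentiable[OF charted_space], of "c k" l] l_differentiable[of "W k"]
      by simp
  qed
  show ?thesis
  proof
    assume crit: "critical_point M N (reduced_action_sum l N) W V"
    show "\<forall>\<delta>\<in>V. (\<Sum>k<N. differential M l (W k) (\<delta> k)) = 0"
    proof
      fix \<delta> assume \<delta>: "\<delta> \<in> V"
      obtain c where c: "realizes_variation M N W \<delta> c"
        using realizing_curves_exist[of N W \<delta>] W V[OF \<delta>] by auto
      with crit \<delta> have "((\<lambda>t. reduced_action_sum l N (\<lambda>k. c k t)) has_real_derivative 0) (at 0)"
        by (auto simp: critical_point_def)
      with deriv[OF c] show "(\<Sum>k<N. differential M l (W k) (\<delta> k)) = 0"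
        by (rule DERIV_unique)
    qed
  next
    assume "\<forall>\<delta>\<in>V. (\<Sum>k<N. differential M l (W k) (\<delta> k)) = 0"
    then show "critical_point M N (reduced_action_sum l N) W V"
      unfolding critical_point_def using deriv by metis
  qed
qed

end

section \<open>Constrained variations and multipliers\<close>

context lie_group
begin

lemma subspace_lie_algebra: "subspace (lie_algebra G M)"
  unfolding lie_algebra_def by (rule subspace_tangent_space)

lemma increments_in: "g k \<in> carrier G \<Longrightarrow> g (k + 1) \<in> carrier G \<Longrightarrow> increments G g k \<in> carrier G"
  by (simp add: increments_def)

lemma reduced_variation_in:
  "g k \<in> carrier G \<Longrightarrow> g (k + 1) \<in> carrier G \<Longrightarrow>
     reduced_variation G M g \<delta> k \<in> tangent_space M (increments G g k)"
  unfolding reduced_variation_def by (intro from_lie_algebra_in increments_in)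

lemma increments_satisfy_constraints:
  assumes "(g k, g (k + 1)) \<in> discrete_constraint_manifold G s f" "j \<in> {1..s}"
  shows "f j (increments G g k) = 0"
proof -
  obtain W where "g k \<in> carrier G" "g (k + 1) = g k \<otimes> W" "W \<in> carrier G" "f j W = 0"
    using assms unfolding discrete_constraint_manifold_def discrete_constraint_set_def by blast
  moreover from this have "increments G g k = W"
    by (simp add: increments_def flip: m_assoc)
  ultimately show ?thesis
    by simp
qed

end

lemma dual_space_linear_form_on: "subspace V \<Longrightarrow> \<alpha> \<in> dual_space V \<Longrightarrow> linear_form_on V \<alpha>"
  by (simp add: dual_space_def linear_form_on_def subspace_scale)

locale constrained_reduced_lagrangian = reduced_lagrangian G M L l
  for G :: "'a monoid" (structure) and M :: "('a, 'e::real_normed_vector) manifold"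
    and L :: "'a \<times> 'a \<Rightarrow> real" and l :: "'a \<Rightarrow> real" +
  fixes a :: "nat \<Rightarrow> ('a, 'e) tangent_vector \<Rightarrow> real" and s N :: nat and g :: "nat \<Rightarrow> 'a"
  assumes a_dual: "\<And>j. j \<in> {1..s} \<Longrightarrow> a j \<in> dual_space (lie_algebra G M)"
    and g_carrier: "\<And>k. k \<le> N \<Longrightarrow> g k \<in> carrier G"
begin

abbreviation (input) balance :: "nat \<Rightarrow> ('a, 'e) tangent_vector \<Rightarrow> real" where
  "balance k \<equiv> momentum_balance (increments G g (k - 1)) (increments G g k)"

text \<open>The multiplier-free condition to which all four statements of the theorem are compared.\<close>

definition balance_on_constraint_subspace :: bool where
  "balance_on_constraint_subspace \<longleftrightarrow>
     (\<forall>k\<in>{1..<N}. \<forall>\<xi>\<in>constraint_subspace G M s a. balance k \<xi> = 0)"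

lemma increments_carrier: "k < N \<Longrightarrow> increments G g k \<in> carrier G"
  using g_carrier by (intro increments_in) auto

lemma linear_balance: "k \<in> {1..<N} \<Longrightarrow> linear (balance k)"
  by (intro linear_momentum_balance increments_carrier) auto

lemma constraint_zero: "j \<in> {1..s} \<Longrightarrow> a j 0 = 0"
  using dual_space_linear_form_on[OF subspace_lie_algebra a_dual, of j]
    subspace_0[OF subspace_lie_algebra]
  unfolding linear_form_on_def by (metis add_0 mult_1 scale_one add_cancel_right_right)

lemma constrained_variation_tangent:
  "\<delta> \<in> constrained_variations G M s a N g \<Longrightarrow> k \<le> N \<Longrightarrow> \<delta> k \<in> tangent_space M (g k)"
  by (simp add: constrained_variations_def)

lemma first_variation_constrained:
  assumes "\<delta> \<in> constrained_variations G M s a N g"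
  shows "first_variation N g \<delta> = (\<Sum>k\<in>{1..<N}. balance k (to_lie_algebra G M (g k) (\<delta> k)))"
  using assms g_carrier
  by (intro first_variation_eq_momentum_balance) (auto simp: constrained_variations_def)

text \<open>Varying one inner site alone shows that the summands of the first variation have to
  vanish separately.\<close>

lemma single_site_variation:
  assumes k: "k \<in> {1..<N}" and \<xi>: "\<xi> \<in> constraint_subspace G M s a"
  defines "\<delta> \<equiv> (\<lambda>_. 0)(k := from_lie_algebra G M (g k) \<xi>)"
  shows "\<delta> \<in> constrained_variations G M s a N g" "first_variation N g \<delta> = balance k \<xi>"
proof -
  have \<xi>': "\<xi> \<in> lie_algebra G M" "\<And>j. j \<in> {1..s} \<Longrightarrow> a j \<xi> = 0"
    using \<xi> by (auto simp: constraint_subspace_def)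
  have to_\<delta>: "to_lie_algebra G M (g i) (\<delta> i) = (if i = k then \<xi> else 0)" if "i \<le> N" for i
    using to_from_lie_algebra[OF g_carrier \<xi>'(1), OF that]
      linear_0[OF linear_to_lie_algebra[OF g_carrier[OF that]]]
    by (auto simp: \<delta>_def)
  show in_V: "\<delta> \<in> constrained_variations G M s a N g"
    unfolding constrained_variations_def
  proof (intro CollectI conjI allI impI ballI)
    show "\<delta> i \<in> tangent_space M (g i)" if "i \<le> N" for i
      using from_lie_algebra_in[OF g_carrier[OF that]] subspace_0[OF subspace_tangent_space]
      by (auto simp: \<delta>_def)
    show "\<delta> 0 = 0" "\<delta> N = 0"
      using k by (auto simp: \<delta>_def)
    show "a j (to_lie_algebra G M (g i) (\<delta> i)) = 0" if "i \<in> {1..<N}" "j \<in> {1..s}" for i j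
      using to_\<delta>[of i] that \<xi>'(2)[of j] constraint_zero[of j] by auto
  qed
  have "first_variation N g \<delta> = (\<Sum>i\<in>{1..<N}. if i = k then balance k \<xi> else 0)"
    unfolding first_variation_constrained[OF in_V]
    by (intro sum.cong refl) (simp add: to_\<delta> linear_0[OF linear_balance] del: One_nat_def)
  then show "first_variation N g \<delta> = balance k \<xi>"
    using k by simp
qed

lemma first_variation_vanishes_iff:
  "(\<forall>\<delta>\<in>constrained_variations G M s a N g. first_variation N g \<delta> = 0) \<longleftrightarrow>
     balance_on_constraint_subspace"
proof
  assume "\<forall>\<delta>\<in>constrained_variations G M s a N g. first_variation N g \<delta> = 0"
  then show balance_on_constraint_subspace
    unfolding balance_on_constraint_subspace_def using single_site_variation by metis
next
  assume b: balance_on_constraint_subspace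
  show "\<forall>\<delta>\<in>constrained_variations G M s a N g. first_variation N g \<delta> = 0"
  proof
    fix \<delta> assume \<delta>: "\<delta> \<in> constrained_variations G M s a N g"
    have "to_lie_algebra G M (g k) (\<delta> k) \<in> constraint_subspace G M s a" if "k \<in> {1..<N}" for k
      using \<delta> that to_lie_algebra_in[OF g_carrier]
      by (simp add: constrained_variations_def constraint_subspace_def)
    then show "first_variation N g \<delta> = 0"
      using b unfolding first_variation_constrained[OF \<delta>] balance_on_constraint_subspace_def
      by (intro sum.neutral) blast
  qed
qed

lemma balance_multipliers_iff:
  "(\<exists>\<mu>::nat \<Rightarrow> nat \<Rightarrow> real. \<forall>k\<in>{1..<N}. \<forall>\<xi>\<in>lie_algebra G M. balance k \<xi> = (\<Sum>j=1..s. \<mu> k j * a j \<xi>)) \<longleftrightarrow>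
     balance_on_constraint_subspace"
proof
  assume "\<exists>\<mu>::nat \<Rightarrow> nat \<Rightarrow> real. \<forall>k\<in>{1..<N}. \<forall>\<xi>\<in>lie_algebra G M. balance k \<xi> = (\<Sum>j=1..s. \<mu> k j * a j \<xi>)"
  then show balance_on_constraint_subspace
    by (auto simp: balance_on_constraint_subspace_def constraint_subspace_def)
next
  assume b: balance_on_constraint_subspace
  have "\<exists>\<mu>. \<forall>\<xi>\<in>lie_algebra G M. balance k \<xi> = (\<Sum>j\<in>{1..s}. \<mu> j * a j \<xi>)" if k: "k \<in> {1..<N}" for k
  proof (rule vanishing_on_common_kernel[OF _ subspace_lie_algebra])
    show "linear_form_on (lie_algebra G M) (a j)" if "j \<in> {1..s}" for j
      using dual_space_linear_form_on subspace_lie_algebra a_dual that by blast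
    show "linear_form_on (lie_algebra G M) (balance k)"
      using linear_balance[OF k] by (simp add: linear_form_on_def linear_add linear_scale)
    show "balance k \<xi> = 0" if "\<xi> \<in> lie_algebra G M" "\<forall>j\<in>{1..s}. a j \<xi> = 0" for \<xi>
      using b k that by (auto simp: balance_on_constraint_subspace_def constraint_subspace_def)
  qed simp
  then show "\<exists>\<mu>::nat \<Rightarrow> nat \<Rightarrow> real. \<forall>k\<in>{1..<N}. \<forall>\<xi>\<in>lie_algebra G M. balance k \<xi> = (\<Sum>j=1..s. \<mu> k j * a j \<xi>)"
    by metis
qed

lemma reduced_euler_lagrange_iff:
  assumes "\<And>k j. k < N \<Longrightarrow> j \<in> {1..s} \<Longrightarrow> f j (increments G g k) = 0"
  shows "reduced_discrete_euler_lagrange G M l s a f N (increments G g) \<longleftrightarrow>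
    balance_on_constraint_subspace"
  using assms unfolding reduced_discrete_euler_lagrange_def balance_multipliers_iff[symmetric]
    momentum_balance_def by blast

text \<open>Left translation identifies the equation at $T_{g_k}G$ with the one on the Lie algebra; it
  carries the left-invariant forms to the \<open>a j\<close>.\<close>

lemma euler_lagrange_iff:
  assumes "\<And>k j. k < N \<Longrightarrow> j \<in> {1..s} \<Longrightarrow> f j (increments G g k) = 0"
  shows "discrete_euler_lagrange G M L s a f N g \<longleftrightarrow> balance_on_constraint_subspace"
proof -
  have "(\<forall>v\<in>tangent_space M (g k). D1 M L (g k, g (k + 1)) v + D2 M L (g (k - 1), g k) v =
        (\<Sum>j=1..s. \<mu> j * left_invariant_form G M (a j) (g k) v)) \<longleftrightarrow>
      (\<forall>\<xi>\<in>lie_algebra G M. balance k \<xi> = (\<Sum>j=1..s. \<mu> j * a j \<xi>))"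
    if k: "k \<in> {1..<N}" for k and \<mu> :: "nat \<Rightarrow> real"
  proof -
    have g [simp]: "g k \<in> carrier G" "g (k + 1) \<in> carrier G" "g (k - 1) \<in> carrier G"
      using k by (auto intro!: g_carrier)
    have "D1 M L (g k, g (k + 1)) v + D2 M L (g (k - 1), g k) v = balance k (to_lie_algebra G M (g k) v)"
      if "v \<in> tangent_space M (g k)" for v
      using euler_lagrange_eq_momentum_balance[OF g(3,1,2) that] k by (simp add: increments_def)
    moreover have "lie_algebra G M = to_lie_algebra G M (g k) ` tangent_space M (g k)"
    proof (intro equalityI subsetI)
      show "\<xi> \<in> to_lie_algebra G M (g k) ` tangent_space M (g k)" if "\<xi> \<in> lie_algebra G M" for \<xi>
        using to_from_lie_algebra[OF g(1) that, symmetric] from_lie_algebra_in[OF g(1)]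
        by (rule image_eqI)
      show "\<xi> \<in> lie_algebra G M" if "\<xi> \<in> to_lie_algebra G M (g k) ` tangent_space M (g k)" for \<xi>
        using that to_lie_algebra_in[OF g(1)] by blast
    qed
    ultimately show ?thesis
      by (simp add: left_invariant_form_def)
  qed
  then have "(\<exists>\<mu>::nat \<Rightarrow> nat \<Rightarrow> real. \<forall>k\<in>{1..<N}. \<forall>v\<in>tangent_space M (g k).
        D1 M L (g k, g (k + 1)) v + D2 M L (g (k - 1), g k) v =
        (\<Sum>j=1..s. \<mu> k j * left_invariant_form G M (a j) (g k) v)) \<longleftrightarrow>
      balance_on_constraint_subspace"
    unfolding balance_multipliers_iff[symmetric] by (intro ex_cong1) (rule ball_cong[OF refl], blast)
  then show ?thesis
    using assms by (simp add: discrete_euler_lagrange_def increments_def)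
qed

lemma critical_action_iff:
  "critical_point M (N + 1) (action_sum L N) g (constrained_variations G M s a N g) \<longleftrightarrow>
     balance_on_constraint_subspace"
  unfolding first_variation_vanishes_iff[symmetric]
  by (intro critical_action_sum_iff g_carrier constrained_variation_tangent)

lemma critical_reduced_action_iff:
  "critical_point M N (reduced_action_sum l N) (increments G g)
       (reduced_variation G M g ` constrained_variations G M s a N g) \<longleftrightarrow>
     balance_on_constraint_subspace"
proof -
  have "reduced_variation G M g \<delta> k \<in> tangent_space M (increments G g k)" if "k < N" for \<delta> k
    using that g_carrier by (intro reduced_variation_in) auto
  then have "critical_point M N (reduced_action_sum l N) (increments G g)
       (reduced_variation G M g ` constrained_variations G M s a N g) \<longleftrightarrow>
      (\<forall>\<delta>\<in>constrained_variations G M s a N g.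
         (\<Sum>k<N. differential M l (increments G g k) (reduced_variation G M g \<delta> k)) = 0)"
    by (subst critical_reduced_action_sum_iff) (auto intro: increments_carrier)
  also have "\<dots> \<longleftrightarrow> (\<forall>\<delta>\<in>constrained_variations G M s a N g. first_variation N g \<delta> = 0)"
    by (intro ball_cong refl arg_cong[where f = "\<lambda>x. x = 0"] first_variation_eq_reduced[symmetric]
        g_carrier constrained_variation_tangent)
  finally show ?thesis
    unfolding first_variation_vanishes_iff .
qed

end

theorem theorem3p2:
  fixes G :: "'a monoid"
    and M :: "('a, 'e::real_normed_vector) manifold"
    and L :: "'a \<times> 'a \<Rightarrow> real" and l :: "'a \<Rightarrow> real"
    and a :: "nat \<Rightarrow> ('a, 'e) tangent_vector \<Rightarrow> real"
    and f :: "nat \<Rightarrow> 'a \<Rightarrow> real"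
    and g W :: "nat \<Rightarrow> 'a" and s N :: nat
  assumes lie_group: "lie_group G M"
    and L_smooth: "smooth_function (prod_manifold M M) L"
    and L_invariant: "\<And>h x y. h \<in> carrier G \<Longrightarrow> x \<in> carrier G \<Longrightarrow> y \<in> carrier G \<Longrightarrow>
          L (h \<otimes>\<^bsub>G\<^esub> x, h \<otimes>\<^bsub>G\<^esub> y) = L (x, y)"
    and l_reduced: "\<And>x y. x \<in> carrier G \<Longrightarrow> y \<in> carrier G \<Longrightarrow> L (x, y) = l (inv\<^bsub>G\<^esub> x \<otimes>\<^bsub>G\<^esub> y)"
    and a_dual: "\<And>j. j \<in> {1..s} \<Longrightarrow> a j \<in> dual_space (lie_algebra G M)"
    and a_independent: "inj_on a {1..s}" "independent (a ` {1..s})"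
    and f_smooth: "\<And>j. j \<in> {1..s} \<Longrightarrow> smooth_function M (f j)"
    and compatible: "compatible_constraints G M s a f"
    and g_carrier: "\<And>k. k \<le> N \<Longrightarrow> g k \<in> carrier G"
    and g_constraint: "\<And>k. k < N \<Longrightarrow> (g k, g (k + 1)) \<in> discrete_constraint_manifold G s f"
    and W_def: "W = increments G g"
  shows "(\<forall>\<delta>\<in>constrained_variations G M s a N g. \<forall>c. realizes_variation M (N + 1) g \<delta> c \<longrightarrow>
            (\<forall>k<N. velocity M (\<lambda>t. inv\<^bsub>G\<^esub> (c k t) \<otimes>\<^bsub>G\<^esub> c (k + 1) t) = reduced_variation G M g \<delta> k)) \<and>
         (critical_point M (N + 1) (action_sum L N) g (constrained_variations G M s a N g) \<longleftrightarrow>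
            discrete_euler_lagrange G M L s a f N g) \<and>
         (discrete_euler_lagrange G M L s a f N g \<longleftrightarrow>
            critical_point M N (reduced_action_sum l N) W
              (reduced_variation G M g ` constrained_variations G M s a N g)) \<and>
         (critical_point M N (reduced_action_sum l N) W
              (reduced_variation G M g ` constrained_variations G M s a N g) \<longleftrightarrow>
            reduced_discrete_euler_lagrange G M l s a f N W)"
proof -
  interpret constrained_reduced_lagrangian G M L l a s N g
    using lie_group L_smooth l_reduced a_dual g_carrier
    by (simp add: constrained_reduced_lagrangian_def reduced_lagrangian_def
        reduced_lagrangian_axioms_def constrained_reduced_lagrangian_axioms_def)
  have constraints: "f j (increments G g k) = 0" if "k < N" "j \<in> {1..s}" for k j
    using that by (intro increments_satisfy_constraints[of g k s f] g_constraint)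
  have "velocity M (\<lambda>t. inv\<^bsub>G\<^esub> (c k t) \<otimes>\<^bsub>G\<^esub> c (k + 1) t) = reduced_variation G M g \<delta> k"
    if "realizes_variation M (N + 1) g \<delta> c" "k < N" for \<delta> c k
  proof -
    have c: "smooth_curve M (c k)" "c k 0 = g k" "velocity M (c k) = \<delta> k"
      "smooth_curve M (c (k + 1))" "c (k + 1) 0 = g (k + 1)" "velocity M (c (k + 1)) = \<delta> (k + 1)"
      using that by (auto simp: realizes_variation_def)
    then show ?thesis
      using velocity_increment[OF smooth_curve_differentiable[OF charted_space c(1)]
          smooth_curve_differentiable[OF charted_space c(4)]]
      by (simp add: reduced_variation_eq)
  qed
  moreover have "discrete_euler_lagrange G M L s a f N g \<longleftrightarrow> balance_on_constraint_subspace"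
    by (rule euler_lagrange_iff) (rule constraints)
  moreover have "reduced_discrete_euler_lagrange G M l s a f N (increments G g) \<longleftrightarrow>
      balance_on_constraint_subspace"
    by (rule reduced_euler_lagrange_iff) (rule constraints)
  ultimately show ?thesis
    unfolding W_def using critical_action_iff critical_reduced_action_iff by blast
qed

end
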